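(* Let $\sigma>1$ be an integer, $\omega$ a primitive $\sigma$-th root of unity, $G$ a matrix of rank $r$ with column set $E$, and $\mathbb{A}$ of order $q$, in the setting described in the context. For $k=0,\dots,\sigma-1$ let $\mathcal{M}_{1,1}(k,\sigma)$ be the set of pairs $(f,g)$ of functions $f,g:E\to\mathbb{A}$ such that $f-g$ is a flow of $G$ over $\mathbb{A}$ and $|\mathrm{supp}(f)|+|\mathrm{supp}(g)|\equiv k\pmod\sigma$. Then, except when $\sigma=2$ and $q=4$, $$\sum_{k=0}^{\sigma-1}\omega^k|\mathcal{M}_{1,1}(k,\sigma)| = (1-\omega)^{2r}(2\omega+\omega^2(q-2))^{|E|-r}\,R\!\left(M(G);\frac{q(2\omega+\omega^2(q-2))}{(1-\omega)^2},\frac{(1-\omega)^2}{2\omega+\omega^2(q-2)}\right).$$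
   Context: Setting (the paper's hypothesis "$G$ is a totally-$\mathbb{P}$ matrix and $\mathbb{A}$ a $\mathbb{P}$-module of order $q$", read as the following cases): either (i) $G$ is the vertex–edge or cycle–edge matrix of a graph with edge set $E$, or a totally unimodular matrix, and $\mathbb{A}$ is an Abelian group of order $q$; or (ii) $G$ is a matrix over $\mathrm{GF}(p^s)$, $\mathbb{A}=\mathrm{GF}(p^s)^d$, $q=p^{sd}$. With $H$ a matrix orthogonally dual to $G$ (same columns, rows of $H$ orthogonal to rows of $G$, ranks summing to $|E|$; integer in case (i)), a flow of $G$ over $\mathbb{A}$ is $h:E\to\mathbb{A}$ with $Hh^T=0$ (equivalently an $\mathbb{A}$-combination of rows of $G$). $\mathrm{supp}(f)=\{e: f(e)\ne0\}$. $M(G)$ is the matroid on $E$ of linear dependence of the columns of $G$, rank function $\mathrm{rk}$, rank $r$; $R(M;\lambda,x)=\sum_{B\subseteq E}\lambda^{r-\mathrm{rk}(B)}x^{|B|-\mathrm{rk}(B)}$.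
   Formalization: In case (i) the dual matrix H is required to be a vertex–edge or cycle–edge matrix of a graph or totally unimodular, not merely integer; for an arbitrary integer H (e.g. G=(0), H=(2), A=Z_2) flows defined by Hh^T=0 are not the A-combinations of rows of G and the identity fails. *)

theory Defs
  imports
    "HOL-Analysis.Analysis"
    "HOL-Number_Theory.Cong"
    "Jordan_Normal_Form.Determinant"
    "Graph_Theory.Arc_Walk"
begin

text \<open>
  A matrix with row set \<open>I\<close> and column set \<open>E\<close> (both finite sets) is a function
  \<open>G :: 'i \<Rightarrow> 'e \<Rightarrow> 'k\<close>, of which only the values on \<open>I \<times> E\<close> matter.
\<close>

definition primitive_root_of_unity :: "nat \<Rightarrow> complex \<Rightarrow> bool" where
  "primitive_root_of_unity n w \<longleftrightarrow> w ^ n = 1 \<and> (\<forall>m. 0 < m \<and> m < n \<longrightarrow> w ^ m \<noteq> 1)"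


subsection \<open>The column matroid\<close>

text \<open>
  Independence is that of the \<^emph>\<open>family\<close> of columns indexed by \<open>S\<close>: parallel edges have
  equal columns but are different (and dependent) elements of the matroid.
\<close>

definition col_indep :: "'i set \<Rightarrow> ('i \<Rightarrow> 'e \<Rightarrow> 'k::field) \<Rightarrow> 'e set \<Rightarrow> bool" where
  "col_indep I G S \<longleftrightarrow>
     (\<forall>c. (\<forall>i\<in>I. (\<Sum>e\<in>S. c e * G i e) = 0) \<longrightarrow> (\<forall>e\<in>S. c e = 0))"

definition rk :: "'i set \<Rightarrow> ('i \<Rightarrow> 'e \<Rightarrow> 'k::field) \<Rightarrow> 'e set \<Rightarrow> nat" where
  "rk I G B = Max {card S | S. S \<subseteq> B \<and> col_indep I G S}"

text \<open>The rank generating polynomial of a matroid on \<open>E\<close> with rank function \<open>\<rho>\<close>.\<close>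

definition rank_poly :: "'e set \<Rightarrow> ('e set \<Rightarrow> nat) \<Rightarrow> complex \<Rightarrow> complex \<Rightarrow> complex" where
  "rank_poly E \<rho> l x = (\<Sum>B\<in>Pow E. l ^ (\<rho> E - \<rho> B) * x ^ (card B - \<rho> B))"

definition orthogonally_dual ::
  "'e set \<Rightarrow> 'i set \<Rightarrow> ('i \<Rightarrow> 'e \<Rightarrow> 'k::field) \<Rightarrow> 'j set \<Rightarrow> ('j \<Rightarrow> 'e \<Rightarrow> 'k) \<Rightarrow> bool" where
  "orthogonally_dual E I G J H \<longleftrightarrow>
     (\<forall>i\<in>I. \<forall>j\<in>J. (\<Sum>e\<in>E. G i e * H j e) = 0) \<and> rk I G E + rk J H E = card E"

text \<open>Matroid notions for an integer matrix are taken over the rationals.\<close>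

definition ratmat :: "('i \<Rightarrow> 'e \<Rightarrow> int) \<Rightarrow> 'i \<Rightarrow> 'e \<Rightarrow> rat" where
  "ratmat G = (\<lambda>i e. of_int (G i e))"


subsection \<open>Totally unimodular matrices and matrices of graphs\<close>

definition totally_unimodular :: "'i set \<Rightarrow> 'e set \<Rightarrow> ('i \<Rightarrow> 'e \<Rightarrow> int) \<Rightarrow> bool" where
  "totally_unimodular I E G \<longleftrightarrow>
     (\<forall>rs cs. distinct rs \<and> distinct cs \<and> set rs \<subseteq> I \<and> set cs \<subseteq> E \<and> length rs = length cs \<longrightarrow>
        det (mat (length rs) (length cs) (\<lambda>(a, b). G (rs ! a) (cs ! b))) \<in> {-1, 0, 1})"

text \<open>
  A graph (loops and parallel edges allowed) carries an arbitrary orientation of its edges, so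
  it is given as a finite digraph whose arcs are the edges. The vertex--edge matrix is the signed
  incidence matrix; the column of a loop is zero.
\<close>

definition vertex_edge_matrix ::
  "('v, 'e) pre_digraph \<Rightarrow> 'i set \<Rightarrow> ('i \<Rightarrow> 'e \<Rightarrow> int) \<Rightarrow> bool" where
  "vertex_edge_matrix D I G \<longleftrightarrow>
     (\<exists>v. bij_betw v I (verts D) \<and>
        (\<forall>i\<in>I. \<forall>e\<in>arcs D.
           G i e = (if head D e = v i then 1 else 0) - (if tail D e = v i then 1 else 0)))"

text \<open>
  Cycles of the graph ignore the orientation: \<open>(e, True)\<close> traverses the edge \<open>e\<close> from tail to head
  and \<open>(e, False)\<close> from head to tail. The condition on \<open>map fst p\<close> excludes going back and forth
  along one edge.
\<close>

definition traversals :: "('v, 'e) pre_digraph \<Rightarrow> ('v, 'e \<times> bool) pre_digraph" where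
  "traversals D = \<lparr> verts = verts D, arcs = arcs D \<times> UNIV,
     tail = (\<lambda>(e, b). if b then tail D e else head D e),
     head = (\<lambda>(e, b). if b then head D e else tail D e) \<rparr>"

definition graph_cycle :: "('v, 'e) pre_digraph \<Rightarrow> ('e \<times> bool) list \<Rightarrow> bool" where
  "graph_cycle D p \<longleftrightarrow> pre_digraph.cycle (traversals D) p \<and> distinct (map fst p)"

definition cycle_vector :: "('e \<times> bool) list \<Rightarrow> 'e \<Rightarrow> int" where
  "cycle_vector p e = (if (e, True) \<in> set p then 1 else if (e, False) \<in> set p then -1 else 0)"

text \<open>
  One row for each cycle of the graph, with an arbitrary choice of the direction in which it is
  traversed; a cycle is identified by its set of edges.
\<close>

definition cycle_edge_matrix ::
  "('v, 'e) pre_digraph \<Rightarrow> 'i set \<Rightarrow> ('i \<Rightarrow> 'e \<Rightarrow> int) \<Rightarrow> bool" where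
  "cycle_edge_matrix D I G \<longleftrightarrow>
     (\<exists>c. (\<forall>i\<in>I. graph_cycle D (c i) \<and> (\<forall>e\<in>arcs D. G i e = cycle_vector (c i) e)) \<and>
        bij_betw (\<lambda>i. fst ` set (c i)) I {fst ` set p | p. graph_cycle D p})"

text \<open>
  The integer matrices considered. The digraph \<open>D\<close> is irrelevant if the matrix is
  totally unimodular.
\<close>

definition graphic_or_unimodular ::
  "('v, 'e) pre_digraph \<Rightarrow> 'i set \<Rightarrow> 'e set \<Rightarrow> ('i \<Rightarrow> 'e \<Rightarrow> int) \<Rightarrow> bool" where
  "graphic_or_unimodular D I E G \<longleftrightarrow>
     (fin_digraph D \<and> arcs D = E \<and> (vertex_edge_matrix D I G \<or> cycle_edge_matrix D I G)) \<or>
     totally_unimodular I E G"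


subsection \<open>Flows\<close>

text \<open>Integer multiples in an Abelian group.\<close>

definition zmult :: "int \<Rightarrow> 'a::ab_group_add \<Rightarrow> 'a" where
  "zmult m a = (if 0 \<le> m then ((+) a ^^ nat m) 0 else - ((+) a ^^ nat (- m)) 0)"

text \<open>
  The flows of a matrix \<open>G\<close>, given by an orthogonally dual matrix \<open>H\<close>; \<open>act\<close> is the action of
  the matrix entries on the module. Functions on \<open>E\<close> are represented by extensional functions,
  so that there are \<open>CARD('a) ^ card E\<close> of them.
\<close>

definition flows ::
  "('k \<Rightarrow> 'a::ab_group_add \<Rightarrow> 'a) \<Rightarrow> 'e set \<Rightarrow> 'j set \<Rightarrow> ('j \<Rightarrow> 'e \<Rightarrow> 'k) \<Rightarrow> ('e \<Rightarrow> 'a) set" where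
  "flows act E J H = {h \<in> E \<rightarrow>\<^sub>E UNIV. \<forall>j\<in>J. (\<Sum>e\<in>E. act (H j e) (h e)) = 0}"

definition supp_on :: "'e set \<Rightarrow> ('e \<Rightarrow> 'a::zero) \<Rightarrow> 'e set" where
  "supp_on E f = {e \<in> E. f e \<noteq> 0}"

text \<open>\<open>F\<close> is the set of flows.\<close>

definition M11 ::
  "'e set \<Rightarrow> ('e \<Rightarrow> 'a::ab_group_add) set \<Rightarrow> nat \<Rightarrow> nat \<Rightarrow> (('e \<Rightarrow> 'a) \<times> ('e \<Rightarrow> 'a)) set" where
  "M11 E F k n = {(f, g). f \<in> E \<rightarrow>\<^sub>E UNIV \<and> g \<in> E \<rightarrow>\<^sub>E UNIV \<and>
     (\<lambda>e\<in>E. f e - g e) \<in> F \<and>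
     [card (supp_on E f) + card (supp_on E g) = k] (mod n)}"

end

theory Submission
  imports Defs
begin

text \<open>
  Substituting \<open>f = h + g\<close> turns the left-hand side into a sum over flows \<open>h\<close> of a product over the
  edges \<open>e\<close>, whose factor is \<open>y = 2 \<omega> + \<omega>\<^sup>2 (q - 2)\<close> if \<open>h e \<noteq> 0\<close> and \<open>y + (1 - \<omega>)\<^sup>2\<close> otherwise.
  Expanding the product over the set \<open>B\<close> of edges contributing \<open>(1 - \<omega>)\<^sup>2\<close> reduces everything to
  counting the flows that vanish on \<open>B\<close>, of which there are \<open>q\<close> to the power \<open>r - rk B\<close>. For this,
  the flow equations are solved on \<open>E - B\<close>: it suffices that each linearly independent set of
  columns of \<open>H\<close> has a left inverse over the ring of coefficients, and then the exponent comes from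
  the rank formula of the dual matroid. The left inverse is integral for a totally unimodular matrix
  by Cramer's rule, and for the matrices of a graph because a given edge closes a cycle with other
  given edges or else lies in a cut avoiding them.
\<close>

subsection \<open>Column rank and orthogonal duality\<close>

lemma col_indep_mono:
  assumes "col_indep I G S" "T \<subseteq> S" "finite S"
  shows "col_indep I G T"
  unfolding col_indep_def
proof (intro allI impI)
  fix c assume c: "\<forall>i\<in>I. (\<Sum>e\<in>T. c e * G i e) = 0"
  define c' where "c' e = (if e \<in> T then c e else 0)" for e
  have "(\<Sum>e\<in>S. c' e * G i e) = (\<Sum>e\<in>T. c e * G i e)" for i
    using assms by (intro sum.mono_neutral_cong_right) (auto simp: c'_def)
  then have "\<forall>e\<in>S. c' e = 0"
    using c assms(1) unfolding col_indep_def by simp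
  then show "\<forall>e\<in>T. c e = 0"
    using assms(2) by (auto simp: c'_def split: if_splits)
qed

lemma col_indep_empty: "col_indep I G {}"
  by (simp add: col_indep_def)

text \<open>The closure operator of the column matroid. The index \<open>e\<close> ranges over the
  whole type, so that no ground set has to be carried along.\<close>

definition col_span :: "'i set \<Rightarrow> ('i \<Rightarrow> 'e \<Rightarrow> 'k::field) \<Rightarrow> 'e set \<Rightarrow> 'e set" where
  "col_span I G T = {e. \<exists>d. \<forall>i\<in>I. G i e = (\<Sum>t\<in>T. d t * G i t)}"

lemma subset_col_span:
  assumes "finite T"
  shows "T \<subseteq> col_span I G T"
proof
  fix e assume "e \<in> T"
  then have "\<forall>i\<in>I. G i e = (\<Sum>t\<in>T. of_bool (t = e) * G i t)"
    using assms by (simp add: if_distrib[where f = "\<lambda>x. x * _"] of_bool_def sum.delta cong: if_cong)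
  then show "e \<in> col_span I G T"
    unfolding col_span_def by (intro CollectI exI)
qed

lemma col_span_trans:
  assumes "e \<in> col_span I G T" "T \<subseteq> col_span I G T'"
  shows "e \<in> col_span I G T'"
proof -
  obtain d where d: "\<And>i. i \<in> I \<Longrightarrow> G i e = (\<Sum>t\<in>T. d t * G i t)"
    using assms(1) by (auto simp: col_span_def)
  have "\<forall>t\<in>T. \<exists>d'. \<forall>i\<in>I. G i t = (\<Sum>u\<in>T'. d' u * G i u)"
    using assms(2) by (auto simp: col_span_def)
  then obtain d' where d': "\<And>t i. t \<in> T \<Longrightarrow> i \<in> I \<Longrightarrow> G i t = (\<Sum>u\<in>T'. d' t u * G i u)"
    by metis
  have "G i e = (\<Sum>u\<in>T'. (\<Sum>t\<in>T. d t * d' t u) * G i u)" if "i \<in> I" for i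
  proof -
    have "G i e = (\<Sum>t\<in>T. \<Sum>u\<in>T'. d t * d' t u * G i u)"
      using that by (simp add: d d' sum_distrib_left mult.assoc)
    also have "\<dots> = (\<Sum>u\<in>T'. \<Sum>t\<in>T. d t * d' t u * G i u)"
      by (rule sum.swap)
    finally show ?thesis by (simp add: sum_distrib_right)
  qed
  then show ?thesis
    unfolding col_span_def by (intro CollectI exI[of _ "\<lambda>u. \<Sum>t\<in>T. d t * d' t u"]) blast
qed

text \<open>In a relation witnessing the dependence, the coefficient of \<open>e\<close> cannot
  vanish, since otherwise the relation would live on \<open>T\<close>. It can therefore be solved
  for column \<open>e\<close>.\<close>

lemma in_col_span_if_dependent:
  assumes "finite T" "col_indep I G T" "\<not> col_indep I G (insert e T)"
  shows "e \<in> col_span I G T"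
proof -
  have e: "e \<notin> T" using assms(2,3) by (auto simp: insert_absorb)
  obtain c where c: "\<And>i. i \<in> I \<Longrightarrow> (\<Sum>t\<in>insert e T. c t * G i t) = 0"
    and nz: "\<exists>t\<in>insert e T. c t \<noteq> 0"
    using assms(3) unfolding col_indep_def by auto
  have eq: "c e * G i e + (\<Sum>t\<in>T. c t * G i t) = 0" if "i \<in> I" for i
    using c[OF that] e assms(1) by simp
  have ce: "c e \<noteq> 0"
  proof
    assume 0: "c e = 0"
    then have "\<forall>i\<in>I. (\<Sum>t\<in>T. c t * G i t) = 0" using eq by simp
    then have "\<forall>t\<in>T. c t = 0" using assms(2) by (simp add: col_indep_def)
    then show False using 0 nz by auto
  qed
  have "G i e = (\<Sum>t\<in>T. - (c t / c e) * G i t)" if "i \<in> I" for i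
  proof -
    have "G i e = - (\<Sum>t\<in>T. c t * G i t) / c e"
      using eq[OF that] ce by (simp add: field_simps eq_neg_iff_add_eq_0)
    then show ?thesis by (simp add: sum_negf sum_divide_distrib)
  qed
  then show ?thesis
    unfolding col_span_def by (intro CollectI exI[of _ "\<lambda>t. - (c t / c e)"]) blast
qed

text \<open>Gaussian elimination: an equation with a nonzero coefficient eliminates one unknown, so
  the induction removes one equation and one unknown together. An equation whose coefficients all
  vanish is simply dropped.\<close>

lemma underdetermined_system:
  fixes C :: "'t \<Rightarrow> 's \<Rightarrow> 'k::field"
  assumes "finite T" "finite S" "card T < card S"
  shows "\<exists>x. (\<exists>s\<in>S. x s \<noteq> 0) \<and> (\<forall>t\<in>T. (\<Sum>s\<in>S. C t s * x s) = 0)"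
  using assms
proof (induction T arbitrary: S C rule: finite_induct)
  case empty
  then obtain s where "s \<in> S" by fastforce
  then show ?case by (intro exI[of _ "\<lambda>_. 1"]) auto
next
  case (insert t T)
  show ?case
  proof (cases "\<forall>s\<in>S. C t s = 0")
    case True
    have "card T < card S" using insert by simp
    from insert.IH[OF insert.prems(1) this, of C] True show ?thesis by auto
  next
    case False
    then obtain s0 where s0: "s0 \<in> S" "C t s0 \<noteq> 0" by auto
    define S' where "S' = S - {s0}"
    have fin: "finite S'" using insert.prems by (simp add: S'_def)
    have "card T < card S'" using insert s0 by (simp add: S'_def)
    \<comment> \<open>These are the remaining equations after subtracting the multiple of equation
      \<open>t\<close> that cancels the unknown \<open>s0\<close>.\<close>
    from insert.IH[OF fin this, of "\<lambda>t' s. C t' s - C t' s0 * C t s / C t s0"]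
    obtain x where x: "\<exists>s\<in>S'. x s \<noteq> 0"
      "\<And>t'. t' \<in> T \<Longrightarrow> (\<Sum>s\<in>S'. (C t' s - C t' s0 * C t s / C t s0) * x s) = 0" by auto
    \<comment> \<open>The value that equation \<open>t\<close> forces on the eliminated
      unknown.\<close>
    define a where "a = - (\<Sum>s\<in>S'. C t s * x s) / C t s0"
    have split: "(\<Sum>s\<in>S. C t' s * (x(s0 := a)) s) = C t' s0 * a + (\<Sum>s\<in>S'. C t' s * x s)" for t'
    proof -
      have "(\<Sum>s\<in>S. C t' s * (x(s0 := a)) s)
          = C t' s0 * a + (\<Sum>s\<in>S'. C t' s * (x(s0 := a)) s)"
        using insert.prems s0 by (subst sum.remove[of S s0]) (auto simp: S'_def)
      also have "(\<Sum>s\<in>S'. C t' s * (x(s0 := a)) s) = (\<Sum>s\<in>S'. C t' s * x s)"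
        by (intro sum.cong) (auto simp: S'_def)
      finally show ?thesis .
    qed
    have "(\<Sum>s\<in>S. C t' s * (x(s0 := a)) s) = 0" if "t' \<in> T" for t'
    proof -
      have "(\<Sum>s\<in>S'. (C t' s - C t' s0 * C t s / C t s0) * x s)
          = (\<Sum>s\<in>S'. C t' s * x s) - C t' s0 / C t s0 * (\<Sum>s\<in>S'. C t s * x s)"
        by (simp add: sum_distrib_left algebra_simps flip: sum_subtractf)
      then show ?thesis using x(2)[OF that] unfolding split by (simp add: a_def)
    qed
    moreover have "(\<Sum>s\<in>S. C t s * (x(s0 := a)) s) = 0"
      unfolding split using s0 by (simp add: a_def)
    moreover have "\<exists>s\<in>S. (x(s0 := a)) s \<noteq> 0" using x(1) by (auto simp: S'_def)
    ultimately show ?thesis by (intro exI[of _ "x(s0 := a)"]) auto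
  qed
qed

text \<open>The Steinitz bound. If \<open>T\<close> were smaller than \<open>S\<close>, the matrix
  \<open>d\<close> expressing the columns of \<open>S\<close> through those of \<open>T\<close>
  would annihilate a nonzero vector, whose entries would be a dependence of
  \<open>S\<close>.\<close>

lemma card_col_indep_le:
  assumes "finite T" "finite S" "col_indep I G S" "S \<subseteq> col_span I G T"
  shows "card S \<le> card T"
proof (rule ccontr)
  assume "\<not> ?thesis"
  then have less: "card T < card S" by simp
  have "\<forall>s\<in>S. \<exists>d. \<forall>i\<in>I. G i s = (\<Sum>t\<in>T. d t * G i t)"
    using assms(4) by (auto simp: col_span_def)
  then obtain d where d: "\<And>s i. s \<in> S \<Longrightarrow> i \<in> I \<Longrightarrow> G i s = (\<Sum>t\<in>T. d s t * G i t)" by metis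
  obtain x where x: "\<exists>s\<in>S. x s \<noteq> 0" "\<And>t. t \<in> T \<Longrightarrow> (\<Sum>s\<in>S. d s t * x s) = 0"
    using underdetermined_system[OF assms(1,2) less, of "\<lambda>t s. d s t"] by auto
  have "(\<Sum>s\<in>S. x s * G i s) = 0" if "i \<in> I" for i
  proof -
    have "(\<Sum>s\<in>S. x s * G i s) = (\<Sum>s\<in>S. \<Sum>t\<in>T. d s t * x s * G i t)"
      by (intro sum.cong) (use d that in \<open>auto simp: sum_distrib_left mult_ac\<close>)
    also have "\<dots> = (\<Sum>t\<in>T. \<Sum>s\<in>S. d s t * x s * G i t)" by (rule sum.swap)
    also have "\<dots> = (\<Sum>t\<in>T. (\<Sum>s\<in>S. d s t * x s) * G i t)" by (simp add: sum_distrib_right)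
    finally show ?thesis using x(2) by simp
  qed
  then show False using assms(3) x(1) by (auto simp: col_indep_def)
qed

section \<open>Rank and bases\<close>

lemma finite_rk_set: "finite B \<Longrightarrow> finite {card S | S. S \<subseteq> B \<and> col_indep I G S}"
  by (rule finite_subset[of _ "card ` Pow B"]) auto

lemma card_le_rk: "finite B \<Longrightarrow> S \<subseteq> B \<Longrightarrow> col_indep I G S \<Longrightarrow> card S \<le> rk I G B"
  unfolding rk_def by (intro Max_ge finite_rk_set) auto

lemma rk_attained:
  assumes "finite B"
  obtains S where "S \<subseteq> B" "col_indep I G S" "card S = rk I G B"
proof -
  have "rk I G B \<in> {card S | S. S \<subseteq> B \<and> col_indep I G S}"
    unfolding rk_def using assms by (intro Max_in finite_rk_set) (auto intro: col_indep_empty)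
  then show thesis using that by auto
qed

lemma rk_le_card: "finite B \<Longrightarrow> rk I G B \<le> card B"
  by (metis card_mono rk_attained)

lemma rk_mono: "finite B \<Longrightarrow> A \<subseteq> B \<Longrightarrow> rk I G A \<le> rk I G B"
  by (metis card_le_rk finite_subset rk_attained subset_trans)

lemma card_eq_rk_if_spanning:
  assumes "finite S" "T \<subseteq> S" "col_indep I G T" "S \<subseteq> col_span I G T"
  shows "card T = rk I G S"
proof (rule antisym)
  obtain S' where S': "S' \<subseteq> S" "col_indep I G S'" "card S' = rk I G S"
    using rk_attained[OF assms(1)] by metis
  have "finite T" "finite S'" using assms(1,2) S'(1) finite_subset by auto
  moreover have "S' \<subseteq> col_span I G T" using S'(1) assms(4) by blast
  ultimately show "rk I G S \<le> card T"
    using card_col_indep_le[of T S' I G] S' by simp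
qed (use assms in \<open>simp add: card_le_rk\<close>)

text \<open>A maximal independent set between \<open>T\<close> and \<open>S\<close> spans
  \<open>S\<close>, because any further column makes it dependent.\<close>

lemma extend_to_basis:
  assumes "finite S" "T \<subseteq> S" "col_indep I G T"
  obtains T' where "T \<subseteq> T'" "T' \<subseteq> S" "col_indep I G T'" "S \<subseteq> col_span I G T'"
proof -
  let ?A = "{T'. T \<subseteq> T' \<and> T' \<subseteq> S \<and> col_indep I G T'}"
  have "finite ?A" by (rule finite_subset[of _ "Pow S"]) (use assms in auto)
  moreover have "T \<in> ?A" using assms by simp
  ultimately obtain T' where T': "T' \<in> ?A" and max: "\<And>X. X \<in> ?A \<Longrightarrow> T' \<subseteq> X \<Longrightarrow> T' = X"
    using finite_has_maximal2[of ?A T] by auto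
  have fin: "finite T'" using T' assms(1) finite_subset by auto
  have "e \<in> col_span I G T'" if e: "e \<in> S" for e
  proof (cases "e \<in> T'")
    case True
    then show ?thesis using subset_col_span[OF fin] by blast
  next
    case False
    then have "insert e T' \<notin> ?A" using max[of "insert e T'"] by auto
    then have "\<not> col_indep I G (insert e T')" using T' e by auto
    moreover have "col_indep I G T'" using T' by simp
    ultimately show ?thesis using in_col_span_if_dependent[OF fin] by metis
  qed
  then have "S \<subseteq> col_span I G T'" by blast
  then show thesis using that[of T'] T' by simp
qed

text \<open>A basis of \<open>T\<close> still spans \<open>E\<close>, hence has as many elements as
  \<open>T\<close> and equals it.\<close>

lemma col_indep_if_spanning_card:
  assumes "finite E" "T \<subseteq> E" "E \<subseteq> col_span I G T" "card T = rk I G E"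
  shows "col_indep I G T"
proof -
  have fin: "finite T" using assms finite_subset by auto
  obtain T' where T': "T' \<subseteq> T" "col_indep I G T'" "T \<subseteq> col_span I G T'"
    using extend_to_basis[OF fin empty_subsetI col_indep_empty] by metis
  have "E \<subseteq> col_span I G T'" using assms(3) col_span_trans[OF _ T'(3)] by (meson subset_iff)
  then have "card T' = card T"
    using card_eq_rk_if_spanning[of E T' I G] assms T' by auto
  then show ?thesis using T' fin card_subset_eq by metis
qed

section \<open>Left inverses over the ring of coefficients\<close>

text \<open>The entries of \<open>L\<close> lie in the same ring as those of \<open>H\<close>. For
  integer matrices this is stronger than independence over the rationals, and it allows cancellation
  in every module over the ring.\<close>

definition left_invertible :: "'j set \<Rightarrow> ('j \<Rightarrow> 'e \<Rightarrow> 'r::comm_ring_1) \<Rightarrow> 'e set \<Rightarrow> bool" where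
  "left_invertible J H T \<longleftrightarrow>
     (\<exists>L. \<forall>t\<in>T. \<forall>u\<in>T. (\<Sum>j\<in>J. L t j * H j u) = (if t = u then 1 else 0))"

text \<open>Dual functionals are built column by column. By independence the new column differs from
  its projection to the old ones; a row where they differ yields a functional that isolates the new
  column, and the old functionals are corrected by multiples of it.\<close>

lemma left_invertible_if_col_indep:
  fixes H :: "'j \<Rightarrow> 'e \<Rightarrow> 'k::field"
  assumes "finite T" "finite J" "col_indep J H T"
  shows "left_invertible J H T"
  using assms
proof (induction T rule: finite_induct)
  case empty
  then show ?case by (simp add: left_invertible_def)
next
  case (insert t T)
  have "col_indep J H T" using insert by (meson col_indep_mono finite.insertI subset_insertI)
  then obtain L where L: "\<And>u v. u \<in> T \<Longrightarrow> v \<in> T \<Longrightarrow>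
      (\<Sum>j\<in>J. L u j * H j v) = (if u = v then 1 else 0)"
    using insert unfolding left_invertible_def by auto
  \<comment> \<open>The coordinates that column \<open>t\<close> would have if it lay in the span of
    \<open>T\<close>.\<close>
  define a where "a u = (\<Sum>j\<in>J. L u j * H j t)" for u
  have "\<not> (\<forall>i\<in>J. (\<Sum>u\<in>insert t T. (if u = t then 1 else - a u) * H i u) = 0)"
    using insert.prems(2) unfolding col_indep_def by force
  moreover have "(\<Sum>u\<in>insert t T. (if u = t then 1 else - a u) * H i u)
      = H i t - (\<Sum>u\<in>T. a u * H i u)" for i
  proof -
    have "(\<Sum>u\<in>T. (if u = t then 1 else - a u) * H i u) = (\<Sum>u\<in>T. - (a u * H i u))"
      by (intro sum.cong) (use insert.hyps in auto)
    then show ?thesis using insert.hyps by (simp add: sum_negf)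
  qed
  ultimately obtain i where i: "i \<in> J" "H i t - (\<Sum>u\<in>T. a u * H i u) \<noteq> 0" by auto
  define \<rho> where "\<rho> = H i t - (\<Sum>u\<in>T. a u * H i u)"
  \<comment> \<open>The functional taking row \<open>i\<close> of a column minus its projection to
    \<open>T\<close>, scaled to be 1 on column \<open>t\<close>; it vanishes on \<open>T\<close>
    because projecting fixes those columns.\<close>
  define l where "l j = ((if j = i then 1 else 0) - (\<Sum>u\<in>T. H i u * L u j)) / \<rho>" for j
  have l: "(\<Sum>j\<in>J. l j * H j v) = (H i v - (\<Sum>u\<in>T. H i u * (\<Sum>j\<in>J. L u j * H j v))) / \<rho>" for v
  proof -
    have "(\<Sum>j\<in>J. l j * H j v) = (\<Sum>j\<in>J. (if j = i then H j v else 0) / \<rho>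
        - (\<Sum>u\<in>T. H i u * L u j * H j v) / \<rho>)"
      by (intro sum.cong) (auto simp: l_def diff_divide_distrib sum_distrib_right left_diff_distrib)
    also have "\<dots> = (\<Sum>j\<in>J. if j = i then H j v else 0) / \<rho>
        - (\<Sum>j\<in>J. \<Sum>u\<in>T. H i u * L u j * H j v) / \<rho>"
      by (simp add: sum_subtractf sum_divide_distrib)
    also have "(\<Sum>j\<in>J. if j = i then H j v else 0) = H i v"
      using i insert.prems by simp
    also have "(\<Sum>j\<in>J. \<Sum>u\<in>T. H i u * L u j * H j v) = (\<Sum>u\<in>T. \<Sum>j\<in>J. H i u * L u j * H j v)"
      by (rule sum.swap)
    also have "\<dots> = (\<Sum>u\<in>T. H i u * (\<Sum>j\<in>J. L u j * H j v))"
      by (simp add: sum_distrib_left mult.assoc)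
    finally show ?thesis by (simp add: diff_divide_distrib)
  qed
  have l_old: "(\<Sum>j\<in>J. l j * H j v) = 0" if "v \<in> T" for v
  proof -
    have "(\<Sum>u\<in>T. H i u * (\<Sum>j\<in>J. L u j * H j v)) = (\<Sum>u\<in>T. if u = v then H i u else 0)"
      by (intro sum.cong) (use L that in auto)
    then show ?thesis using l that insert.hyps by simp
  qed
  have l_new: "(\<Sum>j\<in>J. l j * H j t) = 1"
    using l[of t] i unfolding a_def[symmetric] \<rho>_def[symmetric] by (simp add: \<rho>_def mult.commute)
  define L' where "L' u j = (if u = t then l j else L u j - a u * l j)" for u j
  have L': "(\<Sum>j\<in>J. L' u j * H j v)
      = (\<Sum>j\<in>J. L u j * H j v) - a u * (\<Sum>j\<in>J. l j * H j v)" if "u \<noteq> t" for u v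
    using that by (simp add: L'_def sum_distrib_left algebra_simps sum_subtractf)
  have L't: "(\<Sum>j\<in>J. L' t j * H j v) = (\<Sum>j\<in>J. l j * H j v)" for v
    by (simp add: L'_def)
  have "(\<Sum>j\<in>J. L' u j * H j v) = (if u = v then 1 else 0)"
    if "u \<in> insert t T" "v \<in> insert t T" for u v
  proof (cases "u = t")
    case True
    then show ?thesis using that l_old l_new L't insert.hyps by auto
  next
    case False
    then have "u \<in> T" using that by simp
    show ?thesis
    proof (cases "v = t")
      case True
      then show ?thesis using False L'[OF False, of t] l_new by (simp add: a_def)
    next
      case vt: False
      then have "v \<in> T" using that by simp
      then show ?thesis using L'[OF False, of v] l_old \<open>u \<in> T\<close> L by simp
    qed
  qed
  then show ?case unfolding left_invertible_def by blast
qed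

text \<open>
  Writing \<open>G = G\<^sub>T (1 | C)\<close>, orthogonality and the left cancellability of \<open>G\<^sub>T\<close> give
  \<open>H\<^sub>T = - H\<^bsub>E - T\<^esub> C\<^sup>t\<close>, so the complement of \<open>T\<close> spans the columns of \<open>H\<close>.
\<close>

lemma complement_of_basis:
  assumes "finite E" "finite I" "orthogonally_dual E I G J H"
    and T: "T \<subseteq> E" "col_indep I G T" "card T = rk I G E"
  shows "col_indep J H (E - T)"
proof (rule col_indep_if_spanning_card[OF assms(1)])
  have finT: "finite T" using T assms(1) finite_subset by auto
  have orth: "\<And>i j. i \<in> I \<Longrightarrow> j \<in> J \<Longrightarrow> (\<Sum>e\<in>E. G i e * H j e) = 0"
    and rks: "rk I G E + rk J H E = card E"
    using assms(3) by (auto simp: orthogonally_dual_def)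
  show "card (E - T) = rk J H E"
    using T rks finT by (simp add: card_Diff_subset)
  \<comment> \<open>An extension of \<open>T\<close> to a basis of \<open>E\<close> has the same
    size as \<open>T\<close>, so \<open>T\<close> is a basis already.\<close>
  have span: "E \<subseteq> col_span I G T"
  proof -
    obtain T' where T': "T \<subseteq> T'" "T' \<subseteq> E" "col_indep I G T'" "E \<subseteq> col_span I G T'"
      using extend_to_basis[OF assms(1) T(1,2)] by metis
    then have "card T' = card T" using T(3) card_eq_rk_if_spanning[of E T' I G] assms(1) by auto
    then have "T' = T" using T'(1,2) assms(1) by (metis card_subset_eq finite_subset)
    then show ?thesis using T' by simp
  qed
  then have "\<forall>e\<in>E. \<exists>d. \<forall>i\<in>I. G i e = (\<Sum>t\<in>T. d t * G i t)" by (auto simp: col_span_def)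
  then obtain C where C: "\<And>e i. e \<in> E \<Longrightarrow> i \<in> I \<Longrightarrow> G i e = (\<Sum>t\<in>T. C e t * G i t)" by metis
  have H_T: "H j t = (\<Sum>e\<in>E - T. - C e t * H j e)" if "t \<in> T" "j \<in> J" for t j
  proof -
    \<comment> \<open>The coefficient of column \<open>t\<close> after the columns outside
      \<open>T\<close> have been expanded in the orthogonality relation with row \<open>j\<close> of
      \<open>H\<close>.\<close>
    define c where "c t = H j t + (\<Sum>e\<in>E - T. C e t * H j e)" for t
    have "(\<Sum>t\<in>T. c t * G i t) = 0" if i: "i \<in> I" for i
    proof -
      have "0 = (\<Sum>e\<in>T. G i e * H j e) + (\<Sum>e\<in>E - T. G i e * H j e)"
        using orth[OF i \<open>j \<in> J\<close>] sum.subset_diff[OF T(1) assms(1), of "\<lambda>e. G i e * H j e"]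
        by (simp add: add.commute)
      also have "(\<Sum>e\<in>E - T. G i e * H j e) = (\<Sum>e\<in>E - T. \<Sum>t\<in>T. C e t * G i t * H j e)"
        by (intro sum.cong) (auto simp: C i sum_distrib_right)
      also have "\<dots> = (\<Sum>t\<in>T. \<Sum>e\<in>E - T. C e t * G i t * H j e)" by (rule sum.swap)
      also have "(\<Sum>e\<in>T. G i e * H j e) + \<dots> = (\<Sum>t\<in>T. c t * G i t)"
        by (simp add: c_def sum.distrib algebra_simps sum_distrib_left)
      finally show ?thesis by simp
    qed
    then have "c t = 0" using T(2) that(1) unfolding col_indep_def by blast
    then show ?thesis by (simp add: c_def sum_negf eq_neg_iff_add_eq_0)
  qed
  show "E \<subseteq> col_span J H (E - T)"
  proof
    fix e assume "e \<in> E"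
    show "e \<in> col_span J H (E - T)"
    proof (cases "e \<in> T")
      case True
      then have "\<forall>j\<in>J. H j e = (\<Sum>u\<in>E - T. - C u e * H j u)" using H_T by blast
      then show ?thesis unfolding col_span_def by (intro CollectI exI[of _ "\<lambda>u. - C u e"])
    next
      case False
      then show ?thesis using \<open>e \<in> E\<close> subset_col_span[of "E - T" J H] assms(1) by auto
    qed
  qed
qed auto

section \<open>The rank function of the dual matroid\<close>

lemma orthogonally_dual_sym:
  "orthogonally_dual E I G J H \<Longrightarrow> orthogonally_dual E J H I G"
  by (auto simp: orthogonally_dual_def mult.commute add.commute)

text \<open>A basis of \<open>B\<close> is extended to a basis \<open>T'\<close> of
  \<open>E\<close>. The complement of \<open>T'\<close> is independent in \<open>H\<close>, so
  \<open>E - B - T'\<close> bounds the dual rank from below, and \<open>T' - B\<close> has as many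
  elements as the rank of \<open>E\<close> exceeds that of \<open>B\<close>.\<close>

lemma rk_dual_ge:
  assumes "finite E" "finite I" "orthogonally_dual E I G J H" "B \<subseteq> E"
  shows "card (E - B) + rk I G B \<le> rk J H (E - B) + rk I G E"
proof -
  have finB: "finite B" using assms finite_subset by auto
  obtain T where T: "T \<subseteq> B" "col_indep I G T" "card T = rk I G B"
    using rk_attained[OF finB] by metis
  have "T \<subseteq> E" using T(1) assms(4) by blast
  obtain T' where T': "T \<subseteq> T'" "T' \<subseteq> E" "col_indep I G T'" "E \<subseteq> col_span I G T'"
    using extend_to_basis[OF assms(1) \<open>T \<subseteq> E\<close> T(2)] by metis
  have fin: "finite T'" using T'(2) assms(1) finite_subset by auto
  have c': "card T' = rk I G E"
    using card_eq_rk_if_spanning[OF assms(1) T'(2-)] .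
  \<comment> \<open>The extension adds nothing inside \<open>B\<close>, where \<open>T\<close>
    already has maximal size.\<close>
  have "col_indep I G (T' \<inter> B)" using T'(3) fin by (auto intro: col_indep_mono)
  then have "card (T' \<inter> B) \<le> card T" using card_le_rk[OF finB, of "T' \<inter> B"] T(3) by simp
  then have TB: "card (T' \<inter> B) = card T"
    using card_mono[of "T' \<inter> B" T] T' T fin by auto
  have "col_indep J H (E - T')"
    using complement_of_basis[OF assms(1-3) T'(2,3) c'] .
  then have "col_indep J H (E - B - T')"
    using assms(1) by (auto intro: col_indep_mono)
  then have "card (E - B - T') \<le> rk J H (E - B)"
    using assms(1) by (intro card_le_rk) auto
  moreover have "card (E - B) = card (E - B - T') + card (T' - B)"
  proof -
    have "E - B = (E - B - T') \<union> (T' - B)" using T'(2) by auto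
    then show ?thesis
      using card_Un_disjoint[of "E - B - T'" "T' - B"] assms(1) fin by auto
  qed
  moreover have "card T' = card (T' \<inter> B) + card (T' - B)"
    using card_Un_disjoint[of "T' \<inter> B" "T' - B"] fin by (auto simp: Int_Diff_Un)
  ultimately show ?thesis using TB T(3) c' by linarith
qed

text \<open>The inequality for \<open>G\<close> and \<open>B\<close> and the one for
  \<open>H\<close> and \<open>E - B\<close> are opposite to each other once the two full ranks sum
  to \<open>card E\<close>.\<close>

lemma rk_dual:
  assumes "finite E" "finite I" "finite J" "orthogonally_dual E I G J H" "B \<subseteq> E"
  shows "card (E - B) - rk J H (E - B) = rk I G E - rk I G B"
proof -
  have "card (E - B) + rk I G B \<le> rk J H (E - B) + rk I G E"
    using rk_dual_ge assms by blast
  moreover have "card (E - (E - B)) + rk J H (E - B) \<le> rk I G (E - (E - B)) + rk J H E"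
    using rk_dual_ge[OF assms(1,3) orthogonally_dual_sym[OF assms(4)], of "E - B"] by simp
  moreover have "E - (E - B) = B" using assms(5) by auto
  moreover have "rk I G E + rk J H E = card E" using assms(4) by (simp add: orthogonally_dual_def)
  moreover have "card E = card B + card (E - B)"
    using assms(1,5) by (metis card_Diff_subset card_mono finite_subset le_add_diff_inverse)
  ultimately show ?thesis by auto
qed

subsection \<open>Counting flows\<close>

text \<open>
  Solutions of the system on \<open>S\<close> correspond to arbitrary values on \<open>S - T\<close>: the column relations
  solve for the values on \<open>T\<close>, and the left inverse makes them unique.
\<close>

lemma card_solutions:
  fixes act :: "'r::comm_ring_1 \<Rightarrow> 'b::ab_group_add \<Rightarrow> 'b"
  assumes "Modules.module act" "finite S" "finite J" "T \<subseteq> S"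
    and inv: "left_invertible J H T"
    and span: "\<And>e. e \<in> S - T \<Longrightarrow> \<exists>c. \<forall>j\<in>J. H j e = (\<Sum>t\<in>T. H j t * c t)"
  shows "card {h \<in> S \<rightarrow>\<^sub>E (UNIV :: 'b set). \<forall>j\<in>J. (\<Sum>e\<in>S. act (H j e) (h e)) = 0} =
    CARD('b) ^ (card S - card T)"
proof -
  interpret Modules.module act by fact
  let ?X = "{h \<in> S \<rightarrow>\<^sub>E (UNIV :: 'b set). \<forall>j\<in>J. (\<Sum>e\<in>S. act (H j e) (h e)) = 0}"
  have finT: "finite T" using assms finite_subset by auto
  obtain c where c: "\<And>e j. e \<in> S - T \<Longrightarrow> j \<in> J \<Longrightarrow> H j e = (\<Sum>t\<in>T. H j t * c e t)"
    using span by metis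
  obtain L where L: "\<And>t u. t \<in> T \<Longrightarrow> u \<in> T \<Longrightarrow>
      (\<Sum>j\<in>J. L t j * H j u) = (if t = u then 1 else 0)"
    using inv unfolding left_invertible_def by auto
  \<comment> \<open>Every column outside \<open>T\<close> is replaced by its combination of columns
    of \<open>T\<close>, so values outside \<open>T\<close> only shift the unknowns on
    \<open>T\<close>.\<close>
  have sum_eq: "(\<Sum>e\<in>S. act (H j e) (h e)) =
      (\<Sum>t\<in>T. act (H j t) (h t + (\<Sum>e\<in>S - T. act (c e t) (h e))))" if j: "j \<in> J" for j h
  proof -
    have "(\<Sum>e\<in>S - T. act (H j e) (h e)) =
        (\<Sum>e\<in>S - T. \<Sum>t\<in>T. act (H j t) (act (c e t) (h e)))"
      by (intro sum.cong) (simp_all add: c j scale_sum_left)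
    also have "\<dots> = (\<Sum>t\<in>T. \<Sum>e\<in>S - T. act (H j t) (act (c e t) (h e)))" by (rule sum.swap)
    finally show ?thesis
      using sum.subset_diff[OF \<open>T \<subseteq> S\<close> \<open>finite S\<close>, of "\<lambda>e. act (H j e) (h e)"]
      by (simp add: scale_right_distrib sum.distrib scale_sum_right add.commute)
  qed
  have solves: "(\<forall>j\<in>J. (\<Sum>e\<in>S. act (H j e) (h e)) = 0) \<longleftrightarrow>
      (\<forall>t\<in>T. h t = - (\<Sum>e\<in>S - T. act (c e t) (h e)))" for h
  proof
    assume *: "\<forall>j\<in>J. (\<Sum>e\<in>S. act (H j e) (h e)) = 0"
    \<comment> \<open>The shifted unknowns solve a homogeneous system in the columns of
      \<open>T\<close>; applying row \<open>t\<close> of the left inverse isolates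
      \<open>x t\<close>.\<close>
    define x where "x t = h t + (\<Sum>e\<in>S - T. act (c e t) (h e))" for t
    have x: "(\<Sum>t\<in>T. act (H j t) (x t)) = 0" if "j \<in> J" for j
      using bspec[OF * that] unfolding sum_eq[OF that] x_def .
    show "\<forall>t\<in>T. h t = - (\<Sum>e\<in>S - T. act (c e t) (h e))"
    proof
      fix t assume t: "t \<in> T"
      have "0 = (\<Sum>j\<in>J. act (L t j) (\<Sum>u\<in>T. act (H j u) (x u)))" using x by simp
      also have "\<dots> = (\<Sum>j\<in>J. \<Sum>u\<in>T. act (L t j * H j u) (x u))"
        by (simp add: scale_sum_right)
      also have "\<dots> = (\<Sum>u\<in>T. \<Sum>j\<in>J. act (L t j * H j u) (x u))" by (rule sum.swap)
      also have "\<dots> = (\<Sum>u\<in>T. act (if t = u then 1 else 0) (x u))"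
        by (intro sum.cong) (use L t in \<open>auto simp flip: scale_sum_left\<close>)
      also have "\<dots> = (\<Sum>u\<in>T. if t = u then x u else 0)" by (intro sum.cong) auto
      also have "\<dots> = x t" using finT t by simp
      finally show "h t = - (\<Sum>e\<in>S - T. act (c e t) (h e))"
        by (simp add: x_def eq_neg_iff_add_eq_0)
    qed
  next
    assume "\<forall>t\<in>T. h t = - (\<Sum>e\<in>S - T. act (c e t) (h e))"
    then show "\<forall>j\<in>J. (\<Sum>e\<in>S. act (H j e) (h e)) = 0" by (simp add: sum_eq)
  qed
  let ?ext = "\<lambda>y. \<lambda>e\<in>S. if e \<in> T then - (\<Sum>e'\<in>S - T. act (c e' e) (y e')) else y e"
  have "bij_betw (\<lambda>h. restrict h (S - T)) ?X ((S - T) \<rightarrow>\<^sub>E UNIV)"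
  proof (rule bij_betw_byWitness[where f' = ?ext])
    show "\<forall>h\<in>?X. ?ext (restrict h (S - T)) = h"
    proof
      fix h assume h: "h \<in> ?X"
      then have ht: "h t = - (\<Sum>e\<in>S - T. act (c e t) (h e))" if "t \<in> T" for t
        using that solves by simp
      show "?ext (restrict h (S - T)) = h"
      proof
        fix e
        show "?ext (restrict h (S - T)) e = h e"
          using h by (cases "e \<in> T") (auto simp: PiE_def extensional_def restrict_def ht)
      qed
    qed
    show "\<forall>y\<in>(S - T) \<rightarrow>\<^sub>E UNIV. restrict (?ext y) (S - T) = y"
      by (auto simp: fun_eq_iff restrict_def PiE_def extensional_def)
    show "(\<lambda>h. restrict h (S - T)) ` ?X \<subseteq> (S - T) \<rightarrow>\<^sub>E UNIV"
      by (auto simp: PiE_def)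
    show "?ext ` ((S - T) \<rightarrow>\<^sub>E UNIV) \<subseteq> ?X"
    proof (rule image_subsetI)
      fix y :: "_ \<Rightarrow> 'b" assume "y \<in> (S - T) \<rightarrow>\<^sub>E UNIV"
      have "\<forall>t\<in>T. ?ext y t = - (\<Sum>e\<in>S - T. act (c e t) (?ext y e))"
        using \<open>T \<subseteq> S\<close> by (auto intro!: sum.cong)
      then show "?ext y \<in> ?X" using solves[of "?ext y"] by (simp add: PiE_def)
    qed
  qed
  then have "card ?X = card ((S - T) \<rightarrow>\<^sub>E (UNIV :: 'b set))" by (rule bij_betw_same_card)
  also have "\<dots> = CARD('b) ^ (card S - card T)"
    using assms(2,4) finT by (simp add: card_PiE card_Diff_subset)
  finally show ?thesis .
qed

text \<open>Restriction to \<open>E - B\<close> and extension by zero are mutually inverse, so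
  vanishing on \<open>B\<close> amounts to deleting the columns of \<open>B\<close> from the
  system.\<close>

lemma card_flows_vanishing_on:
  fixes act :: "'r::comm_ring_1 \<Rightarrow> 'b::ab_group_add \<Rightarrow> 'b"
  assumes "Modules.module act" "finite E" "B \<subseteq> E"
  shows "card {h \<in> flows act E J H. \<forall>e\<in>B. h e = 0} =
    card {h \<in> (E - B) \<rightarrow>\<^sub>E (UNIV :: 'b set). \<forall>j\<in>J. (\<Sum>e\<in>E - B. act (H j e) (h e)) = 0}"
    (is "card ?X = card ?Y")
proof (rule bij_betw_same_card)
  interpret Modules.module act by fact
  let ?ext = "\<lambda>y. \<lambda>e\<in>E. if e \<in> B then 0 else y e"
  have sum_eq: "(\<Sum>e\<in>E. act (H j e) (h e)) = (\<Sum>e\<in>E - B. act (H j e) (h e))"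
    if "\<forall>e\<in>B. h e = 0" for h j
    using assms that by (intro sum.mono_neutral_right) auto
  have sum_res: "(\<Sum>e\<in>E - B. act (H j e) (restrict h (E - B) e)) = (\<Sum>e\<in>E - B. act (H j e) (h e))"
    for h j by (intro sum.cong) auto
  have sum_ext: "(\<Sum>e\<in>E - B. act (H j e) (?ext y e)) = (\<Sum>e\<in>E - B. act (H j e) (y e))"
    for y j by (intro sum.cong) auto
  show "bij_betw (\<lambda>h. restrict h (E - B)) ?X ?Y"
  proof (rule bij_betw_byWitness[where f' = ?ext])
    show "\<forall>h\<in>?X. ?ext (restrict h (E - B)) = h"
      by (auto simp: fun_eq_iff restrict_def PiE_def extensional_def flows_def)
    show "\<forall>y\<in>?Y. restrict (?ext y) (E - B) = y"
      by (auto simp: fun_eq_iff restrict_def PiE_def extensional_def)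
    show "(\<lambda>h. restrict h (E - B)) ` ?X \<subseteq> ?Y"
    proof (rule image_subsetI)
      fix h assume h: "h \<in> ?X"
      then have "\<forall>j\<in>J. (\<Sum>e\<in>E - B. act (H j e) (h e)) = 0"
        using sum_eq[of h] by (simp add: flows_def)
      then show "restrict h (E - B) \<in> ?Y" using sum_res by (simp add: PiE_def)
    qed
    show "?ext ` ?Y \<subseteq> ?X"
    proof (rule image_subsetI)
      fix y assume y: "y \<in> ?Y"
      have 0: "\<forall>e\<in>B. ?ext y e = 0" using assms(3) by auto
      then have "\<forall>j\<in>J. (\<Sum>e\<in>E. act (H j e) (?ext y e)) = 0"
        using y sum_eq[OF 0] sum_ext[of _ y] by simp
      then show "?ext y \<in> ?X" using 0 by (simp add: PiE_def flows_def)
    qed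
  qed
qed

text \<open>A dependence over the field is made integral by multiplying with the left inverse.\<close>

lemma col_combination_if_in_col_span:
  fixes \<phi> :: "'r::comm_ring_1 \<Rightarrow> 'k::field"
  assumes "inj_comm_ring_hom \<phi>" "finite T" "left_invertible J H T"
    and "e \<in> col_span J (\<lambda>j e. \<phi> (H j e)) T"
  shows "\<exists>c. \<forall>j\<in>J. H j e = (\<Sum>t\<in>T. H j t * c t)"
proof -
  interpret inj_comm_ring_hom \<phi> by fact
  obtain d where d: "\<And>j. j \<in> J \<Longrightarrow> \<phi> (H j e) = (\<Sum>t\<in>T. d t * \<phi> (H j t))"
    using assms(4) by (auto simp: col_span_def)
  obtain L where L: "\<And>t u. t \<in> T \<Longrightarrow> u \<in> T \<Longrightarrow>
      (\<Sum>j\<in>J. L t j * H j u) = (if t = u then 1 else 0)"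
    using assms(3) unfolding left_invertible_def by auto
  \<comment> \<open>The left inverse applied to column \<open>e\<close>; its image under
    \<open>\<phi>\<close> recovers the field coefficients \<open>d\<close> on
    \<open>T\<close>.\<close>
  define c where "c t = (\<Sum>j\<in>J. L t j * H j e)" for t
  have c: "\<phi> (c t) = d t" if t: "t \<in> T" for t
  proof -
    have "\<phi> (c t) = (\<Sum>j\<in>J. \<phi> (L t j) * (\<Sum>u\<in>T. d u * \<phi> (H j u)))"
      unfolding c_def hom_sum hom_mult by (intro sum.cong) (simp_all add: d)
    also have "\<dots> = (\<Sum>j\<in>J. \<Sum>u\<in>T. d u * \<phi> (L t j * H j u))"
      by (simp add: sum_distrib_left hom_mult mult_ac)
    also have "\<dots> = (\<Sum>u\<in>T. \<Sum>j\<in>J. d u * \<phi> (L t j * H j u))" by (rule sum.swap)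
    also have "\<dots> = (\<Sum>u\<in>T. d u * \<phi> (\<Sum>j\<in>J. L t j * H j u))"
      by (simp add: hom_sum sum_distrib_left)
    also have "\<dots> = (\<Sum>u\<in>T. if t = u then d u else 0)"
      by (intro sum.cong) (use L t in auto)
    finally show ?thesis using t assms(2) by simp
  qed
  have "H j e = (\<Sum>t\<in>T. H j t * c t)" if "j \<in> J" for j
  proof -
    have "\<phi> (H j e) = \<phi> (\<Sum>t\<in>T. H j t * c t)"
      unfolding d[OF that] hom_sum hom_mult by (intro sum.cong) (simp_all add: c mult.commute)
    then show ?thesis by simp
  qed
  then show ?thesis by blast
qed

text \<open>The system is solved for a basis of the columns of \<open>H\<close> outside
  \<open>B\<close>, and duality turns the number of free values into a rank difference of
  \<open>G\<close>. The map \<open>\<phi>\<close> embeds the ring of coefficients into the field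
  over which the matroid is taken.\<close>

lemma card_flows_vanishing_on_rk:
  fixes act :: "'r::comm_ring_1 \<Rightarrow> 'b::ab_group_add \<Rightarrow> 'b" and \<phi> :: "'r \<Rightarrow> 'k::field"
    and I :: "'i set" and J :: "'j set"
  assumes act: "Modules.module act" and \<phi>: "inj_comm_ring_hom \<phi>"
    and fin: "finite E" "finite I" "finite J"
    and dual: "orthogonally_dual E I G J (\<lambda>j e. \<phi> (H j e))"
    and inv: "\<And>T. T \<subseteq> E \<Longrightarrow> col_indep J (\<lambda>j e. \<phi> (H j e)) T \<Longrightarrow> left_invertible J H T"
    and "B \<subseteq> E"
  shows "card {h \<in> flows act E J H. \<forall>e\<in>B. h e = 0} = CARD('b) ^ (rk I G E - rk I G B)"
proof -
  let ?H = "\<lambda>j e. \<phi> (H j e)"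
  have finB: "finite (E - B)" using fin by simp
  obtain T where T: "T \<subseteq> E - B" "col_indep J ?H T" "E - B \<subseteq> col_span J ?H T"
    using extend_to_basis[OF finB empty_subsetI col_indep_empty] by metis
  have "finite T" using T(1) finB finite_subset by auto
  have left: "left_invertible J H T" using inv[of T] T(1,2) by auto
  have "\<exists>c. \<forall>j\<in>J. H j e = (\<Sum>t\<in>T. H j t * c t)" if "e \<in> E - B - T" for e
    using col_combination_if_in_col_span[OF \<phi> \<open>finite T\<close> left] T(3) that by blast
  then have "card {h \<in> flows act E J H. \<forall>e\<in>B. h e = 0} = CARD('b) ^ (card (E - B) - card T)"
    using card_flows_vanishing_on[OF act fin(1) \<open>B \<subseteq> E\<close>, of J H]
      card_solutions[OF act finB fin(3) T(1) left] by simp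
  moreover have "card T = rk J ?H (E - B)"
    by (rule card_eq_rk_if_spanning[OF finB T])
  ultimately show ?thesis using rk_dual[OF fin dual \<open>B \<subseteq> E\<close>] by simp
qed

subsection \<open>Totally unimodular matrices\<close>

abbreviation minor :: "('i \<Rightarrow> 'e \<Rightarrow> 'r) \<Rightarrow> 'i list \<Rightarrow> 'e list \<Rightarrow> 'r::comm_ring_1" where
  "minor H rs cs \<equiv> det (mat (length rs) (length cs) (\<lambda>(a, b). H (rs ! a) (cs ! b)))"

text \<open>Translates between sums over a set of rows or columns and the numbered positions of a
  matrix.\<close>

lemma sum_list_index:
  fixes xs :: "'a list"
  assumes "distinct xs"
  obtains ix where "\<And>a. a < length xs \<Longrightarrow> ix (xs ! a) = a" "\<And>x. x \<in> set xs \<Longrightarrow> ix x < length xs"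
    "\<And>g :: 'a \<Rightarrow> 'r::comm_monoid_add. (\<Sum>x\<in>set xs. g x) = (\<Sum>a<length xs. g (xs ! a))"
proof
  have bij: "bij_betw ((!) xs) {..<length xs} (set xs)" by (rule bij_betw_nth[OF assms]) auto
  let ?ix = "the_inv_into {..<length xs} ((!) xs)"
  show "?ix (xs ! a) = a" if "a < length xs" for a
    using bij that by (intro the_inv_into_f_f) (auto simp: bij_betw_def)
  show "?ix x < length xs" if "x \<in> set xs" for x
    using bij_betw_the_inv_into[OF bij] that by (auto simp: bij_betw_def)
  show "(\<Sum>x\<in>set xs. g x) = (\<Sum>a<length xs. g (xs ! a))" for g :: "'a \<Rightarrow> 'r"
    using sum.reindex_bij_betw[OF bij, of g] by simp
qed

text \<open>
  If all bordered minors vanished, their expansion along the new row would be a dependence between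
  the columns, with the old minor as the coefficient of the new column.
\<close>

lemma nonzero_minor_if_col_indep:
  fixes H :: "'j \<Rightarrow> 'e \<Rightarrow> int"
  assumes "finite T" "col_indep J (ratmat H) T"
  shows "\<exists>rs cs. distinct rs \<and> distinct cs \<and> set rs \<subseteq> J \<and> set cs = T \<and> length rs = length cs \<and>
    minor H rs cs \<noteq> 0"
  using assms
proof (induction T rule: finite_induct)
  case empty
  then show ?case by (intro exI[of _ "[]"]) auto
next
  case (insert t T)
  have "col_indep J (ratmat H) T"
    using insert by (meson col_indep_mono finite.insertI subset_insertI)
  then obtain rs cs where IH: "distinct rs" "distinct cs" "set rs \<subseteq> J" "set cs = T"
    "length rs = length cs" "minor H rs cs \<noteq> 0" using insert.IH by auto
  define n where "n = length cs"
  define cs' where "cs' = cs @ [t]"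
  have cs': "distinct cs'" "set cs' = insert t T" "length cs' = Suc n"
    using IH insert.hyps by (auto simp: cs'_def n_def)
  \<comment> \<open>The old minor bordered by row \<open>i\<close> and column \<open>t\<close>, both
    in last position.\<close>
  define M where "M i = mat (Suc n) (Suc n) (\<lambda>(a, b). H ((rs @ [i]) ! a) (cs' ! b))" for i
  have M: "M i \<in> carrier_mat (Suc n) (Suc n)" for i by (simp add: M_def)
  have del: "mat_delete (M i) n b = mat_delete (M i') n b" for i i' b
    using IH(5) unfolding mat_delete_def M_def n_def[symmetric]
    by (intro cong_mat) (auto simp: nth_append n_def)
  \<comment> \<open>Deleting the last row removes all trace of \<open>i\<close>, so these cofactors
    are common to all \<open>M i\<close>; the row \<open>undefined\<close> is an arbitrary
    representative.\<close>
  define k where "k b = cofactor (M undefined) n b" for b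
  have k: "cofactor (M i) n b = k b" for i b
    unfolding k_def cofactor_def del[of i b undefined] ..
  have kn: "k n \<noteq> 0"
  proof -
    have "mat_delete (M undefined) n n = mat (length rs) (length cs) (\<lambda>(a, b). H (rs ! a) (cs ! b))"
      using IH(5) unfolding mat_delete_def M_def cs'_def
      by (intro eq_matI) (auto simp: nth_append n_def)
    then show ?thesis using IH(6) by (simp add: k_def cofactor_def)
  qed
  have expand: "det (M i) = (\<Sum>b<Suc n. H i (cs' ! b) * k b)" for i
  proof -
    have "det (M i) = (\<Sum>b<Suc n. M i $$ (n, b) * k b)"
      using laplace_expansion_row[OF M, of n i] by (simp add: k)
    also have "\<dots> = (\<Sum>b<Suc n. H i (cs' ! b) * k b)"
      using IH(5) by (intro sum.cong) (auto simp: M_def n_def nth_append)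
    finally show ?thesis .
  qed
  have "\<exists>i\<in>J. det (M i) \<noteq> 0"
  proof (rule ccontr)
    assume "\<not> ?thesis"
    then have zero: "det (M i) = 0" if "i \<in> J" for i using that by blast
    obtain ix where ix: "\<And>a. a < length cs' \<Longrightarrow> ix (cs' ! a) = a"
      and sum_ix: "\<And>g :: 'e \<Rightarrow> rat. (\<Sum>x\<in>set cs'. g x) = (\<Sum>a<length cs'. g (cs' ! a))"
      using sum_list_index[OF cs'(1)] by metis
    have "(\<Sum>e\<in>insert t T. of_int (k (ix e)) * ratmat H i e) = 0" if "i \<in> J" for i
    proof -
      have "(\<Sum>e\<in>insert t T. of_int (k (ix e)) * ratmat H i e)
          = (\<Sum>b<Suc n. of_int (k (ix (cs' ! b))) * ratmat H i (cs' ! b))"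
        using sum_ix[of "\<lambda>e. of_int (k (ix e)) * ratmat H i e"] unfolding cs'(2,3) .
      also have "\<dots> = (\<Sum>b<Suc n. of_int (H i (cs' ! b) * k b))"
        by (intro sum.cong) (use ix cs'(3) in \<open>auto simp: ratmat_def\<close>)
      also have "\<dots> = of_int (det (M i))" unfolding expand by simp
      finally show ?thesis using zero[OF that] by simp
    qed
    then have "\<forall>e\<in>insert t T. of_int (k (ix e)) = (0::rat)"
      by (intro insert.prems[unfolded col_indep_def, THEN spec, THEN mp] ballI)
    then have "of_int (k (ix t)) = (0::rat)" by blast
    moreover have "ix t = n"
      using ix[of n] cs'(3) by (simp add: cs'_def n_def)
    ultimately show False using kn by simp
  qed
  then obtain i where i: "i \<in> J" "det (M i) \<noteq> 0" by blast
  \<comment> \<open>A repeated row would make the determinant vanish.\<close>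
  have "i \<notin> set rs"
  proof
    assume "i \<in> set rs"
    then obtain a where a: "a < n" "rs ! a = i" using IH(5) by (auto simp: in_set_conv_nth n_def)
    have "row (M i) a = row (M i) n"
      using a IH(5) by (intro eq_vecI) (auto simp: M_def nth_append n_def)
    then show False using det_identical_rows[OF M, of a n i] a i(2) by simp
  qed
  then have "distinct (rs @ [i])" "set (rs @ [i]) \<subseteq> J" "length (rs @ [i]) = length cs'"
    using IH i cs' by (auto simp: n_def)
  moreover have "minor H (rs @ [i]) cs' \<noteq> 0"
    using i(2) IH(5) cs'(3) by (simp add: M_def n_def)
  ultimately show ?case using cs'(1,2) by blast
qed

text \<open>A nonzero maximal minor on the columns of \<open>T\<close> is 1 or -1, so the inverse of
  that square submatrix is integral.\<close>

lemma left_invertible_if_totally_unimodular: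
  assumes tu: "totally_unimodular J E H" and fin: "finite E" "finite J"
    and T: "T \<subseteq> E" "col_indep J (ratmat H) T"
  shows "left_invertible J H T"
proof -
  have "finite T" using T fin finite_subset by auto
  then obtain rs cs where rc: "distinct rs" "distinct cs" "set rs \<subseteq> J" "set cs = T"
    "length rs = length cs" "minor H rs cs \<noteq> 0"
    using nonzero_minor_if_col_indep T(2) by metis
  define n where "n = length cs"
  define M where "M = mat n n (\<lambda>(a, b). H (rs ! a) (cs ! b))"
  have M: "M \<in> carrier_mat n n" by (simp add: M_def)
  have "det M \<in> {-1, 0, 1}" "det M \<noteq> 0"
    using tu rc T(1) unfolding totally_unimodular_def M_def n_def by metis+
  then have det: "det M * det M = 1" by auto
  obtain cx where cx: "\<And>a. a < length cs \<Longrightarrow> cx (cs ! a) = a" "\<And>x. x \<in> set cs \<Longrightarrow> cx x < length cs"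
    using sum_list_index[OF rc(2)] by metis
  obtain rx where rx: "\<And>a. a < length rs \<Longrightarrow> rx (rs ! a) = a"
    and sum_rx: "\<And>g :: _ \<Rightarrow> int. (\<Sum>x\<in>set rs. g x) = (\<Sum>a<length rs. g (rs ! a))"
    using sum_list_index[OF rc(1)] by metis
  \<comment> \<open>Since \<open>det M\<close> is its own inverse, \<open>det M\<close> times the
    adjugate inverts \<open>M\<close>; rows outside the minor get coefficient 0.\<close>
  define L where "L t j = (if j \<in> set rs then det M * adj_mat M $$ (cx t, rx j) else 0)" for t j
  have "(\<Sum>j\<in>J. L t j * H j u) = (if t = u then 1 else 0)" if "t \<in> T" "u \<in> T" for t u
  proof -
    obtain a b where ab: "a < n" "b < n" "t = cs ! a" "u = cs ! b"
      using \<open>t \<in> T\<close> \<open>u \<in> T\<close> rc(4) unfolding n_def by (metis in_set_conv_nth)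
    have "(\<Sum>j\<in>J. L t j * H j u) = (\<Sum>j\<in>set rs. L t j * H j u)"
      using rc(3) fin by (intro sum.mono_neutral_right) (auto simp: L_def)
    also have "\<dots> = (\<Sum>c<n. L t (rs ! c) * H (rs ! c) u)"
      using sum_rx[of "\<lambda>j. L t j * H j u"] rc(5) by (simp add: n_def)
    also have "\<dots> = (\<Sum>c<n. det M * (adj_mat M $$ (a, c) * M $$ (c, b)))"
      using rc(5) ab cx rx by (intro sum.cong) (auto simp: L_def M_def n_def)
    also have "\<dots> = det M * (adj_mat M * M) $$ (a, b)"
      using ab adj_mat(1)[OF M] M
      by (simp add: scalar_prod_def sum_distrib_left atLeast0LessThan)
    also have "\<dots> = (if a = b then 1 else 0)"
      using ab det unfolding adj_mat(3)[OF M] by simp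
    also have "\<dots> = (if t = u then 1 else 0)"
      using ab rc(2) by (auto simp: nth_eq_iff_index_eq n_def)
    finally show ?thesis .
  qed
  then show ?thesis unfolding left_invertible_def by blast
qed

subsection \<open>Matrices of graphs\<close>

lemma wf_digraph_traversals:
  assumes "wf_digraph D"
  shows "wf_digraph (traversals D)"
proof -
  interpret wf_digraph D by fact
  show ?thesis by unfold_locales (auto simp: traversals_def)
qed

lemma traversals_simps:
  "verts (traversals D) = verts D"
  "arcs (traversals D) = arcs D \<times> UNIV"
  "tail (traversals D) (e, b) = (if b then tail D e else head D e)"
  "head (traversals D) (e, b) = (if b then head D e else tail D e)"
  by (simp_all add: traversals_def)

text \<open>Using an edge again, in either direction, would visit both of its ends again, among them
  the start of the path.\<close>

lemma distinct_edges_if_apath: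
  assumes "wf_digraph D" "pre_digraph.apath (traversals D) u p v"
  shows "distinct (map fst p)"
  using assms(2)
proof (induction p arbitrary: u)
  interpret T: wf_digraph "traversals D" by (rule wf_digraph_traversals[OF assms(1)])
  case (Cons x p)
  obtain e b where x: "x = (e, b)" by fastforce
  have p: "T.apath (head (traversals D) x) p v" "T.awalk (head (traversals D) x) p v"
    and u: "u = tail (traversals D) x" "u \<notin> set (T.awalk_verts (head (traversals D) x) p)"
    using Cons.prems by (auto simp: T.apath_Cons_iff T.apath_def T.awalk_Cons_iff)
  have "e \<notin> fst ` set p"
  proof
    assume "e \<in> fst ` set p"
    then obtain b' where b': "(e, b') \<in> set p" by force
    have "tail (traversals D) (e, b') \<in> set (T.awalk_verts (head (traversals D) x) p)"
      "head (traversals D) (e, b') \<in> set (T.awalk_verts (head (traversals D) x) p)"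
      using T.awalk_verts_arc1 T.awalk_verts_arc2 b' p(2) T.awalkE by metis+
    then show False using u unfolding x by (cases b; cases b') (auto simp: traversals_simps)
  qed
  then show ?case using Cons.IH[OF p(1)] x by simp
qed simp

text \<open>Potential differences telescope along a walk. For a closed walk the sum is 0, which
  makes cycle vectors orthogonal to cuts and to the rows of the vertex-edge matrix.\<close>

lemma sum_cycle_vector:
  fixes \<pi> :: "'v \<Rightarrow> int"
  assumes "pre_digraph.cas (traversals D) u p v" "distinct (map fst p)"
    and "finite E" "fst ` set p \<subseteq> E"
  shows "(\<Sum>e\<in>E. cycle_vector p e * (\<pi> (head D e) - \<pi> (tail D e))) = \<pi> v - \<pi> u"
  using assms
proof (induction p arbitrary: u)
  case Nil
  then show ?case by (simp add: cycle_vector_def pre_digraph.cas.simps)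
next
  case (Cons x p)
  obtain e b where x: "x = (e, b)" by fastforce
  have e: "e \<notin> fst ` set p" "e \<in> E" using Cons.prems x by auto
  then have notin: "(e, b') \<notin> set p" for b' by force
  have cv: "cycle_vector (x # p) e' = (if e' = e then (if b then 1 else -1) else cycle_vector p e')" for e'
    using notin by (auto simp: cycle_vector_def x)
  have cve: "cycle_vector p e = 0" using notin by (simp add: cycle_vector_def)
  have "(\<Sum>e\<in>E. cycle_vector (x # p) e * (\<pi> (head D e) - \<pi> (tail D e)))
      = (if b then 1 else -1) * (\<pi> (head D e) - \<pi> (tail D e))
        + (\<Sum>e\<in>E. cycle_vector p e * (\<pi> (head D e) - \<pi> (tail D e)))"
    unfolding sum.remove[OF \<open>finite E\<close> e(2)] cv cve by (auto intro: sum.cong)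
  also have "(\<Sum>e\<in>E. cycle_vector p e * (\<pi> (head D e) - \<pi> (tail D e))) = \<pi> v - \<pi> (head (traversals D) x)"
    using Cons by (intro Cons.IH) (auto simp: pre_digraph.cas.simps)
  finally show ?case
    using Cons.prems(1) by (auto simp: x traversals_simps pre_digraph.cas.simps)
qed

text \<open>
  Here \<open>W\<close> is the set of vertices reachable from the head of \<open>t\<close> along edges of \<open>U\<close>.
\<close>

lemma cycle_or_cut:
  assumes "fin_digraph D" "t \<in> arcs D" "U \<subseteq> arcs D" "t \<notin> U"
  obtains (cycle) p where "graph_cycle D p" "t \<in> fst ` set p" "fst ` set p \<subseteq> insert t U"
  | (cut) W where "head D t \<in> W" "tail D t \<notin> W" "\<And>e. e \<in> U \<Longrightarrow> head D e \<in> W \<longleftrightarrow> tail D e \<in> W"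
proof -
  interpret D: fin_digraph D by fact
  have wf: "wf_digraph D" ..
  interpret T: wf_digraph "traversals D" by (rule wf_digraph_traversals[OF wf])
  define W where "W = {w. \<exists>p. T.awalk (head D t) p w \<and> fst ` set p \<subseteq> U}"
  have step: "head (traversals D) (e, b) \<in> W"
    if e: "e \<in> U" and w: "tail (traversals D) (e, b) \<in> W" for e b
  proof -
    obtain p where p: "T.awalk (head D t) p (tail (traversals D) (e, b))" "fst ` set p \<subseteq> U"
      using w by (auto simp: W_def)
    have arc: "(e, b) \<in> arcs (traversals D)" using e assms(3) by (auto simp: traversals_simps)
    then have "T.awalk (tail (traversals D) (e, b)) [(e, b)] (head (traversals D) (e, b))"
      by (rule T.arc_implies_awalk)
    then have "T.awalk (head D t) (p @ [(e, b)]) (head (traversals D) (e, b))"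
      by (rule T.awalk_appendI[OF p(1)])
    moreover have "fst ` set (p @ [(e, b)]) \<subseteq> U" using p(2) e by simp
    ultimately show ?thesis unfolding W_def by blast
  qed
  show thesis
  proof (cases "tail D t \<in> W")
    case True
    then obtain q where q: "T.awalk (head D t) q (tail D t)" "fst ` set q \<subseteq> U" by (auto simp: W_def)
    \<comment> \<open>A walk from head to tail of \<open>t\<close> is shortened to a path, so that
      adding \<open>t\<close> gives a cycle.\<close>
    define p where "p = T.awalk_to_apath q"
    have p: "T.apath (head D t) p (tail D t)" "fst ` set p \<subseteq> U"
      using T.apath_awalk_to_apath[OF q(1)] T.awalk_to_apath_subset[OF q(1)] q(2)
      unfolding p_def by auto
    have "T.awalk (tail D t) ((t, True) # p) (tail D t)"
      using p(1) assms(2) by (auto simp: T.awalk_Cons_iff traversals_simps T.apath_def)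
    moreover have "distinct (tl (T.awalk_verts (tail D t) ((t, True) # p)))"
      using p(1) by (simp add: T.apath_def traversals_simps)
    moreover have "distinct (map fst ((t, True) # p))"
      using distinct_edges_if_apath[OF wf p(1)] p(2) assms(4) by auto
    ultimately have "graph_cycle D ((t, True) # p)"
      unfolding graph_cycle_def T.cycle_def by blast
    then show ?thesis using cycle[of "(t, True) # p"] p(2) by auto
  next
    case False
    have "T.awalk (head D t) [] (head D t)"
      using assms(2) by (simp add: T.awalk_Nil_iff traversals_simps)
    then have "head D t \<in> W" unfolding W_def by (intro CollectI exI[of _ "[]"]) simp
    moreover have "head D e \<in> W \<longleftrightarrow> tail D e \<in> W" if "e \<in> U" for e
      using step[OF that, of True] step[OF that, of False] by (auto simp: traversals_simps)
    ultimately show ?thesis using cut False by blast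
  qed
qed

lemma cycle_vector_eq_0_iff: "cycle_vector p e = 0 \<longleftrightarrow> e \<notin> fst ` set p"
proof -
  have "e \<in> fst ` set p \<longleftrightarrow> (\<exists>b. (e, b) \<in> set p)" by force
  then have "e \<in> fst ` set p \<longleftrightarrow> (e, True) \<in> set p \<or> (e, False) \<in> set p"
    by (simp add: ex_bool_eq)
  then show ?thesis by (auto simp: cycle_vector_def)
qed

lemma graph_cycleD:
  assumes "graph_cycle D p"
  obtains u where "pre_digraph.cas (traversals D) u p u" "distinct (map fst p)" "fst ` set p \<subseteq> arcs D"
proof -
  obtain u where "pre_digraph.awalk (traversals D) u p u" and p: "distinct (map fst p)"
    using assms by (auto simp: graph_cycle_def pre_digraph.cycle_def)
  then have "pre_digraph.cas (traversals D) u p u" "set p \<subseteq> arcs D \<times> UNIV"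
    by (simp_all add: pre_digraph.awalk_def traversals_simps)
  with p show thesis by (intro that[of u]) auto
qed

section \<open>Integral left inverses for incidence and cycle matrices\<close>

text \<open>For each \<open>t\<close> in \<open>T\<close> the dichotomy is applied to the other
  edges of \<open>T\<close>: a cycle would be a dependence of columns, and a cut provides the row of
  the left inverse.\<close>

lemma left_invertible_if_vertex_edge_matrix:
  assumes D: "fin_digraph D" and G: "vertex_edge_matrix D I G" and "finite I"
    and T: "T \<subseteq> arcs D" "col_indep I (ratmat G) T"
  shows "left_invertible I G T"
proof -
  interpret D: fin_digraph D by fact
  have finT: "finite T" using T(1) D.finite_arcs by (rule finite_subset)
  obtain v where v: "bij_betw v I (verts D)"
    and Gv: "\<And>i e. i \<in> I \<Longrightarrow> e \<in> arcs D \<Longrightarrow>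
      G i e = (if head D e = v i then 1 else 0) - (if tail D e = v i then 1 else 0)"
    using G unfolding vertex_edge_matrix_def by auto
  have "\<exists>l. \<forall>u\<in>T. (\<Sum>i\<in>I. l i * G i u) = (if t = u then 1 else 0)" if t: "t \<in> T" for t
  proof -
    have "t \<in> arcs D" "T - {t} \<subseteq> arcs D" "t \<notin> T - {t}" using t T(1) by auto
    from D this show ?thesis
    proof (cases rule: cycle_or_cut)
      case (cycle p)
      obtain u where p: "pre_digraph.cas (traversals D) u p u" "distinct (map fst p)"
        using graph_cycleD[OF cycle(1)] by metis
      have sub: "fst ` set p \<subseteq> T" using cycle(3) t by auto
      have "(\<Sum>e\<in>T. of_int (cycle_vector p e) * ratmat G i e) = 0" if i: "i \<in> I" for i
      proof -
        have "(\<Sum>e\<in>T. of_int (cycle_vector p e) * ratmat G i e) =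
            of_int (\<Sum>e\<in>T. cycle_vector p e * ((if head D e = v i then 1 else 0) -
              (if tail D e = v i then 1 else 0)))"
          unfolding of_int_sum by (intro sum.cong) (use T(1) Gv[OF i] in \<open>auto simp: ratmat_def\<close>)
        also have "\<dots> = 0"
          using sum_cycle_vector[OF p finT sub, of "\<lambda>w. if w = v i then 1 else 0"] by simp
        finally show ?thesis .
      qed
      then have "\<forall>e\<in>T. of_int (cycle_vector p e) = (0 :: rat)"
        by (intro T(2)[unfolded col_indep_def, THEN spec, THEN mp] ballI)
      then show ?thesis using cycle(2) t by (simp add: cycle_vector_eq_0_iff)
    next
      case (cut W)
      \<comment> \<open>Adding the rows of the vertices in \<open>W\<close> leaves nonzero entries
        only at edges crossing the cut; within \<open>T\<close> this is \<open>t\<close> alone,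
        which enters \<open>W\<close> and so gets 1.\<close>
      define l :: "_ \<Rightarrow> int" where "l i = (if v i \<in> W then 1 else 0)" for i
      have sum_v: "(\<Sum>i\<in>I. l i * (if w = v i then 1 else 0)) = (if w \<in> W then 1 else 0)"
        if "w \<in> verts D" for w
      proof -
        have "(\<Sum>i\<in>I. l i * (if w = v i then 1 else 0)) =
            (\<Sum>x\<in>verts D. (if x \<in> W then 1 else 0) * (if w = x then 1 else 0))"
          unfolding l_def
          by (rule sum.reindex_bij_betw[OF v,
              of "\<lambda>x. (if x \<in> W then 1 else 0) * (if w = x then 1 else 0)"])
        also have "\<dots> = (\<Sum>x\<in>verts D. if w = x then (if x \<in> W then 1 else 0) else 0)"
          by (intro sum.cong) auto
        finally show ?thesis using that by simp
      qed
      have "(\<Sum>i\<in>I. l i * G i u) = (if t = u then 1 else 0)" if u: "u \<in> T" for u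
      proof -
        have "u \<in> arcs D" using u T(1) by auto
        then have "(\<Sum>i\<in>I. l i * G i u) = (\<Sum>i\<in>I. l i * (if head D u = v i then 1 else 0)) -
            (\<Sum>i\<in>I. l i * (if tail D u = v i then 1 else 0))"
          unfolding sum_subtractf[symmetric] by (intro sum.cong) (auto simp: Gv)
        also have "\<dots> = (if head D u \<in> W then 1 else 0) - (if tail D u \<in> W then 1 else 0)"
          using \<open>u \<in> arcs D\<close> by (simp add: sum_v)
        finally show ?thesis using cut u by (cases "u = t") auto
      qed
      then show ?thesis by blast
    qed
  qed
  then show ?thesis unfolding left_invertible_def by metis
qed

text \<open>The roles of cycle and cut are exchanged: the dichotomy is applied to the edges outside
  \<open>T\<close>. A cycle then meets \<open>T\<close> in \<open>t\<close> alone and provides the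
  row of the left inverse, while a cut has all its edges in \<open>T\<close> and would be a
  dependence.\<close>

lemma left_invertible_if_cycle_edge_matrix:
  assumes D: "fin_digraph D" and G: "cycle_edge_matrix D I G" and "finite I"
    and T: "T \<subseteq> arcs D" "col_indep I (ratmat G) T"
  shows "left_invertible I G T"
proof -
  interpret D: fin_digraph D by fact
  obtain c where c: "\<And>i. i \<in> I \<Longrightarrow> graph_cycle D (c i)"
    and Gc: "\<And>i e. i \<in> I \<Longrightarrow> e \<in> arcs D \<Longrightarrow> G i e = cycle_vector (c i) e"
    and bij: "bij_betw (\<lambda>i. fst ` set (c i)) I {fst ` set p | p. graph_cycle D p}"
    using G unfolding cycle_edge_matrix_def by blast
  have "\<exists>l. \<forall>u\<in>T. (\<Sum>i\<in>I. l i * G i u) = (if t = u then 1 else 0)" if t: "t \<in> T" for t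
  proof -
    have "t \<in> arcs D" "arcs D - T \<subseteq> arcs D" "t \<notin> arcs D - T" using t T(1) by auto
    from D this show ?thesis
    proof (cases rule: cycle_or_cut)
      case (cycle p)
      have "fst ` set p \<in> (\<lambda>i. fst ` set (c i)) ` I"
        using bij cycle(1) unfolding bij_betw_def by blast
      then obtain i where i: "i \<in> I" "fst ` set (c i) = fst ` set p" by auto
      \<comment> \<open>The row of the matrix may traverse \<open>t\<close> in either direction;
        multiplying by its own sign makes the entry 1.\<close>
      define l where "l j = (if j = i then cycle_vector (c i) t else 0)" for j
      have "(\<Sum>j\<in>I. l j * G j u) = (if t = u then 1 else 0)" if u: "u \<in> T" for u
      proof -
        have "(\<Sum>j\<in>I. l j * G j u) = (\<Sum>j\<in>I. if j = i then cycle_vector (c i) t * G j u else 0)"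
          by (intro sum.cong) (auto simp: l_def)
        also have "\<dots> = cycle_vector (c i) t * cycle_vector (c i) u"
          using i(1) \<open>finite I\<close> Gc[OF i(1)] u T(1) by auto
        also have "\<dots> = (if t = u then 1 else 0)"
        proof (cases "t = u")
          case True
          have "cycle_vector (c i) t \<noteq> 0" using i(2) cycle(2) by (simp add: cycle_vector_eq_0_iff)
          moreover have "cycle_vector (c i) t \<in> {-1, 0, 1}" by (simp add: cycle_vector_def)
          ultimately show ?thesis using True by auto
        next
          case False
          then have "u \<notin> fst ` set (c i)" using i(2) cycle(3) u by auto
          then show ?thesis using False by (simp add: cycle_vector_eq_0_iff)
        qed
        finally show ?thesis .
      qed
      then show ?thesis by blast
    next
      case (cut W)
      \<comment> \<open>Differences of this indicator vanish outside \<open>T\<close> and are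
        orthogonal to every cycle, so they are coefficients of a dependence, with 1 at
        \<open>t\<close>.\<close>
      define \<pi> :: "_ \<Rightarrow> int" where "\<pi> w = (if w \<in> W then 1 else 0)" for w
      have "(\<Sum>e\<in>T. of_int (\<pi> (head D e) - \<pi> (tail D e)) * ratmat G i e) = 0" if i: "i \<in> I" for i
      proof -
        obtain u where p: "pre_digraph.cas (traversals D) u (c i) u" "distinct (map fst (c i))"
          "fst ` set (c i) \<subseteq> arcs D"
          using graph_cycleD[OF c[OF i]] by metis
        have "(\<Sum>e\<in>T. of_int (\<pi> (head D e) - \<pi> (tail D e)) * ratmat G i e) =
            of_int (\<Sum>e\<in>T. cycle_vector (c i) e * (\<pi> (head D e) - \<pi> (tail D e)))"
          unfolding of_int_sum
          by (intro sum.cong) (use T(1) Gc[OF i] in \<open>auto simp: ratmat_def\<close>)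
        also have "(\<Sum>e\<in>T. cycle_vector (c i) e * (\<pi> (head D e) - \<pi> (tail D e))) =
            (\<Sum>e\<in>arcs D. cycle_vector (c i) e * (\<pi> (head D e) - \<pi> (tail D e)))"
          using T(1) cut(3) by (intro sum.mono_neutral_left) (auto simp: \<pi>_def)
        also have "\<dots> = 0" using sum_cycle_vector[OF p(1,2) _ p(3), of \<pi>] by simp
        finally show ?thesis by simp
      qed
      then have "\<forall>e\<in>T. of_int (\<pi> (head D e) - \<pi> (tail D e)) = (0 :: rat)"
        by (intro T(2)[unfolded col_indep_def, THEN spec, THEN mp] ballI)
      then show ?thesis using cut(1,2) t by (auto simp: \<pi>_def)
    qed
  qed
  then show ?thesis unfolding left_invertible_def by metis
qed

lemma left_invertible_if_graphic_or_unimodular: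
  assumes "graphic_or_unimodular D J E H" "finite E" "finite J"
    and "T \<subseteq> E" "col_indep J (ratmat H) T"
  shows "left_invertible J H T"
  using assms left_invertible_if_totally_unimodular[of J E H T]
    left_invertible_if_vertex_edge_matrix[of D J H T]
    left_invertible_if_cycle_edge_matrix[of D J H T]
  unfolding graphic_or_unimodular_def by blast

subsection \<open>The weighted sum over pairs\<close>

text \<open>The power of \<open>w\<close> depends only on the exponent modulo \<open>n\<close>, so
  the residue classes recombine into one sum over all pairs, which is then reindexed by
  \<open>h = f - g\<close>.\<close>

lemma sum_M11:
  fixes F :: "('e \<Rightarrow> 'a::{ab_group_add,finite}) set" and w :: complex
  assumes "finite E" "n > 0" "w ^ n = 1" "F \<subseteq> E \<rightarrow>\<^sub>E UNIV"
  shows "(\<Sum>k<n. w ^ k * of_nat (card (M11 E F k n))) =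
    (\<Sum>h\<in>F. \<Sum>g\<in>E \<rightarrow>\<^sub>E UNIV. w ^ (card (supp_on E (\<lambda>e. h e + g e)) + card (supp_on E g)))"
proof -
  define P where "P = {(f, g). f \<in> E \<rightarrow>\<^sub>E UNIV \<and> g \<in> E \<rightarrow>\<^sub>E UNIV \<and> (\<lambda>e\<in>E. f e - g e) \<in> F}"
  define N where "N = (\<lambda>(f :: 'e \<Rightarrow> 'a, g :: 'e \<Rightarrow> 'a). card (supp_on E f) + card (supp_on E g))"
  have finE: "finite (E \<rightarrow>\<^sub>E (UNIV :: 'a set))" using assms(1) by (simp add: finite_PiE)
  then have "finite ((E \<rightarrow>\<^sub>E (UNIV :: 'a set)) \<times> (E \<rightarrow>\<^sub>E (UNIV :: 'a set)))" by simp
  then have finP: "finite P" by (rule rev_finite_subset) (auto simp: P_def)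
  have w_mod: "w ^ (m mod n) = w ^ m" for m
  proof -
    have "w ^ m = w ^ (n * (m div n) + m mod n)" by simp
    also have "\<dots> = w ^ (m mod n)" unfolding power_add power_mult assms(3) by simp
    finally show ?thesis by simp
  qed
  have "w ^ k * of_nat (card (M11 E F k n)) = (\<Sum>p\<in>{p\<in>P. N p mod n = k}. w ^ N p)" if "k < n" for k
  proof -
    have "M11 E F k n = {p\<in>P. N p mod n = k}"
      using that by (auto simp: M11_def P_def N_def cong_def)
    moreover have "(\<Sum>p\<in>{p\<in>P. N p mod n = k}. w ^ N p) = (\<Sum>p\<in>{p\<in>P. N p mod n = k}. w ^ k)"
    proof (intro sum.cong refl)
      fix p assume "p \<in> {p\<in>P. N p mod n = k}"
      then show "w ^ N p = w ^ k" using w_mod[of "N p"] by simp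
    qed
    ultimately show ?thesis by simp
  qed
  then have "(\<Sum>k<n. w ^ k * of_nat (card (M11 E F k n))) =
      (\<Sum>k<n. \<Sum>p\<in>{p\<in>P. N p mod n = k}. w ^ N p)"
    by (intro sum.cong) auto
  also have "\<dots> = (\<Sum>p\<in>P. w ^ N p)"
    using finP assms(2) by (intro sum.group) auto
  also have "\<dots> = (\<Sum>(h, g)\<in>F \<times> (E \<rightarrow>\<^sub>E UNIV).
      w ^ (card (supp_on E (\<lambda>e. h e + g e)) + card (supp_on E g)))"
  proof (rule sum.reindex_bij_witness[where
        i = "\<lambda>(h, g). (\<lambda>e\<in>E. h e + g e, g)" and j = "\<lambda>(f, g). (\<lambda>e\<in>E. f e - g e, g)"])
    fix p assume "p \<in> P"
    then obtain f g where p: "p = (f, g)" "f \<in> E \<rightarrow>\<^sub>E UNIV" "g \<in> E \<rightarrow>\<^sub>E UNIV"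
      "(\<lambda>e\<in>E. f e - g e) \<in> F" by (auto simp: P_def)
    show "(case case p of (f, g) \<Rightarrow> (\<lambda>e\<in>E. f e - g e, g) of (h, g) \<Rightarrow> (\<lambda>e\<in>E. h e + g e, g)) = p"
      using p(2) by (auto simp: p(1) fun_eq_iff restrict_def PiE_def extensional_def)
    show "(case p of (f, g) \<Rightarrow> (\<lambda>e\<in>E. f e - g e, g)) \<in> F \<times> (E \<rightarrow>\<^sub>E UNIV)"
      using p by simp
    have "supp_on E (\<lambda>e. (\<lambda>e\<in>E. f e - g e) e + g e) = supp_on E f"
      by (auto simp: supp_on_def)
    then show "(case case p of (f, g) \<Rightarrow> (\<lambda>e\<in>E. f e - g e, g) of (h, g) \<Rightarrow>
        w ^ (card (supp_on E (\<lambda>e. h e + g e)) + card (supp_on E g))) = w ^ N p"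
      by (simp add: p(1) N_def)
  next
    fix p assume "p \<in> F \<times> (E \<rightarrow>\<^sub>E (UNIV :: 'a set))"
    then obtain h g where p: "p = (h, g)" "h \<in> F" "h \<in> E \<rightarrow>\<^sub>E UNIV" "g \<in> E \<rightarrow>\<^sub>E UNIV"
      using assms(4) by auto
    have *: "(\<lambda>e\<in>E. (\<lambda>e\<in>E. h e + g e) e - g e) = h"
      using p(3) by (auto simp: fun_eq_iff restrict_def PiE_def extensional_def)
    show "(case case p of (h, g) \<Rightarrow> (\<lambda>e\<in>E. h e + g e, g) of (f, g) \<Rightarrow> (\<lambda>e\<in>E. f e - g e, g)) = p"
      using * by (simp add: p(1))
    show "(case p of (h, g) \<Rightarrow> (\<lambda>e\<in>E. h e + g e, g)) \<in> P"
      using p * by (simp add: P_def)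
  qed
  also have "\<dots> = (\<Sum>h\<in>F. \<Sum>g\<in>E \<rightarrow>\<^sub>E UNIV.
      w ^ (card (supp_on E (\<lambda>e. h e + g e)) + card (supp_on E g)))"
    by (simp add: sum.cartesian_product)
  finally show ?thesis .
qed

text \<open>The summand is \<open>w\<^sup>2\<close> except at \<open>a = 0\<close> and
  \<open>a = - b\<close>, where one factor is lost; if \<open>b = 0\<close> these coincide and both
  factors are lost.\<close>

lemma sum_weight_difference:
  fixes b :: "'a::{ab_group_add,finite}" and w :: complex
  shows "(\<Sum>a\<in>UNIV. (if b + a \<noteq> 0 then w else 1) * (if a \<noteq> 0 then w else 1)) =
    (if b = 0 then (1 - w)\<^sup>2 else 0) + (2 * w + w\<^sup>2 * (of_nat CARD('a) - 2))"
proof -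
  \<comment> \<open>Each exceptional value corrects \<open>w\<^sup>2\<close> by
    \<open>w * (1 - w)\<close>; when they coincide, both corrections apply and
    \<open>(1 - w)\<^sup>2\<close> is still missing from 1.\<close>
  have "(\<Sum>a\<in>UNIV. (if b + a \<noteq> 0 then w else 1) * (if a \<noteq> 0 then w else 1)) =
      (\<Sum>a\<in>UNIV. w\<^sup>2 + (if a = - b then w * (1 - w) else 0) + (if a = 0 then w * (1 - w) else 0) +
        (if a = 0 then (if b = 0 then (1 - w)\<^sup>2 else 0) else 0))"
  proof (intro sum.cong refl)
    fix a
    have "b + a = 0 \<longleftrightarrow> a = - b" by (simp add: eq_neg_iff_add_eq_0 add.commute)
    moreover have "w\<^sup>2 + w * (1 - w) = w" "w + w * (1 - w) + (1 - w)\<^sup>2 = 1"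
      by (simp_all add: algebra_simps power2_eq_square)
    ultimately show "(if b + a \<noteq> 0 then w else 1) * (if a \<noteq> 0 then w else 1) =
        w\<^sup>2 + (if a = - b then w * (1 - w) else 0) + (if a = 0 then w * (1 - w) else 0) +
        (if a = 0 then (if b = 0 then (1 - w)\<^sup>2 else 0) else 0)"
      by (cases "a = 0"; cases "b = 0") (simp_all add: power2_eq_square)
  qed
  also have "\<dots> = of_nat CARD('a) * w\<^sup>2 + w * (1 - w) + w * (1 - w) +
      (if b = 0 then (1 - w)\<^sup>2 else 0)"
    by (simp add: sum.distrib)
  also have "\<dots> = (if b = 0 then (1 - w)\<^sup>2 else 0) + (2 * w + w\<^sup>2 * (of_nat CARD('a) - 2))"
    by (simp add: algebra_simps power2_eq_square)
  finally show ?thesis .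
qed

lemma power_card_supp_on:
  "finite E \<Longrightarrow> w ^ card (supp_on E f) = (\<Prod>e\<in>E. if f e \<noteq> 0 then w else (1::complex))"
  unfolding supp_on_def prod_constant[symmetric] by (rule prod.inter_filter)

text \<open>The weight factors over the edges and the values of \<open>g\<close> are chosen
  independently, so the sum of products is a product of sums.\<close>

lemma sum_weights_eq_prod:
  fixes h :: "'e \<Rightarrow> 'a::{ab_group_add,finite}" and w :: complex
  assumes "finite E"
  shows "(\<Sum>g\<in>E \<rightarrow>\<^sub>E UNIV. w ^ (card (supp_on E (\<lambda>e. h e + g e)) + card (supp_on E g))) =
    (\<Prod>e\<in>E. (if h e = 0 then (1 - w)\<^sup>2 else 0) + (2 * w + w\<^sup>2 * (of_nat CARD('a) - 2)))"
proof -
  have "(\<Sum>g\<in>E \<rightarrow>\<^sub>E UNIV. w ^ (card (supp_on E (\<lambda>e. h e + g e)) + card (supp_on E g))) =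
      (\<Sum>g\<in>E \<rightarrow>\<^sub>E UNIV. \<Prod>e\<in>E. (if h e + g e \<noteq> 0 then w else 1) * (if g e \<noteq> 0 then w else 1))"
    using assms by (simp only: power_add power_card_supp_on prod.distrib)
  also have "\<dots> = (\<Prod>e\<in>E. \<Sum>a\<in>UNIV. (if h e + a \<noteq> 0 then w else 1) * (if a \<noteq> 0 then w else 1))"
    using assms by (intro prod_sum_PiE[symmetric]) auto
  finally show ?thesis by (simp only: sum_weight_difference)
qed

section \<open>The rank generating polynomial\<close>

lemma sum_prod_vanishing:
  fixes F :: "('e \<Rightarrow> 'a::zero) set" and x y :: complex
  assumes "finite E" "finite F"
  shows "(\<Sum>h\<in>F. \<Prod>e\<in>E. (if h e = 0 then x else 0) + y) =
    (\<Sum>B\<in>Pow E. x ^ card B * y ^ card (E - B) * of_nat (card {h\<in>F. \<forall>e\<in>B. h e = 0}))"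
proof -
  have prod_eq: "(\<Prod>e\<in>B. if h e = 0 then x else 0) = (if \<forall>e\<in>B. h e = 0 then x ^ card B else 0)"
    if "finite B" for B and h :: "'e \<Rightarrow> 'a"
    using that by (auto intro: prod_zero)
  have "(\<Sum>h\<in>F. \<Prod>e\<in>E. (if h e = 0 then x else 0) + y) =
      (\<Sum>h\<in>F. \<Sum>B\<in>Pow E. if \<forall>e\<in>B. h e = 0 then x ^ card B * y ^ card (E - B) else 0)"
    unfolding prod_add[OF assms(1)]
  proof (intro sum.cong refl)
    fix h :: "'e \<Rightarrow> 'a" and B assume "B \<in> Pow E"
    then have "finite B" using assms(1) finite_subset by blast
    then show "(\<Prod>e\<in>B. if h e = 0 then x else 0) * (\<Prod>e\<in>E - B. y) =
        (if \<forall>e\<in>B. h e = 0 then x ^ card B * y ^ card (E - B) else 0)"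
      by (simp only: prod_eq prod_constant) simp
  qed
  also have "\<dots> = (\<Sum>B\<in>Pow E. \<Sum>h\<in>F. if \<forall>e\<in>B. h e = 0 then x ^ card B * y ^ card (E - B) else 0)"
    by (rule sum.swap)
  also have "\<dots> = (\<Sum>B\<in>Pow E. x ^ card B * y ^ card (E - B) * of_nat (card {h\<in>F. \<forall>e\<in>B. h e = 0}))"
    by (intro sum.cong refl) (simp add: assms(2) mult.commute flip: sum.inter_filter)
  finally show ?thesis .
qed

text \<open>Termwise comparison of exponents; \<open>mono\<close> and \<open>le\<close> ensure that
  the subtractions of natural numbers are exact.\<close>

lemma rank_poly_rescaled:
  fixes x y :: complex and \<rho> :: "'e set \<Rightarrow> nat"
  assumes "finite E" "x \<noteq> 0" "y \<noteq> 0"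
    and mono: "\<And>B. B \<subseteq> E \<Longrightarrow> \<rho> B \<le> \<rho> E" and le: "\<And>B. B \<subseteq> E \<Longrightarrow> \<rho> B \<le> card B"
  shows "(\<Sum>B\<in>Pow E. x ^ card B * y ^ card (E - B) * q ^ (\<rho> E - \<rho> B)) =
    x ^ \<rho> E * y ^ (card E - \<rho> E) * rank_poly E \<rho> (q * y / x) (x / y)"
  unfolding rank_poly_def sum_distrib_left
proof (intro sum.cong refl)
  fix B assume "B \<in> Pow E"
  then have B: "B \<subseteq> E" by simp
  define c where "c = \<rho> E - \<rho> B"
  define n where "n = card B - \<rho> B"
  define m where "m = card E - \<rho> E"
  have E: "\<rho> E = c + \<rho> B" using mono[OF B] by (simp add: c_def)
  have cB: "card B = n + \<rho> B" using le[OF B] by (simp add: n_def)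
  have "card E = m + \<rho> E" using le[of E] by (simp add: m_def)
  moreover have "card E = card B + card (E - B)"
    using assms(1) B by (metis card_Diff_subset card_mono finite_subset le_add_diff_inverse)
  \<comment> \<open>Both sides equal \<open>card E - \<rho> B\<close>; this balances the powers of
    \<open>y\<close>.\<close>
  ultimately have "m + c = n + card (E - B)" using E cB by simp
  then have "y ^ m * y ^ c = y ^ n * y ^ card (E - B)" by (simp flip: power_add)
  then have y_pow: "y ^ m * y ^ c / y ^ n = y ^ card (E - B)" using assms(3) by simp
  have "x ^ (c + \<rho> B) * y ^ m * ((q * y / x) ^ c * (x / y) ^ n) =
      x ^ (n + \<rho> B) * q ^ c * (y ^ m * y ^ c / y ^ n)"
    using assms(2) by (simp add: power_add power_divide power_mult_distrib)
  then show "x ^ card B * y ^ card (E - B) * q ^ (\<rho> E - \<rho> B) =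
      x ^ \<rho> E * y ^ (card E - \<rho> E) *
      ((q * y / x) ^ (\<rho> E - \<rho> B) * (x / y) ^ (card B - \<rho> B))"
    unfolding c_def[symmetric] n_def[symmetric] m_def[symmetric]
    unfolding E cB y_pow by (simp add: mult_ac)
qed

text \<open>A zero would give \<open>w * (q - 2) = - 2\<close>. Taking norms leaves only
  \<open>q = 4\<close> for positive \<open>q\<close>, hence \<open>w = - 1\<close> and
  \<open>n = 2\<close>, the excluded case.\<close>

lemma weight_nonzero:
  fixes w :: complex
  assumes "primitive_root_of_unity n w" "n > 1" "q > 0" "\<not> (n = 2 \<and> q = 4)"
  shows "2 * w + w\<^sup>2 * (of_nat q - 2) \<noteq> 0"
proof
  assume zero: "2 * w + w\<^sup>2 * (of_nat q - 2) = 0"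
  have w: "w ^ n = 1" "\<And>m. 0 < m \<Longrightarrow> m < n \<Longrightarrow> w ^ m \<noteq> 1"
    using assms(1) by (auto simp: primitive_root_of_unity_def)
  have norm: "norm w = 1" using w(1) assms(2)
    by (metis norm_one norm_power power_eq_1_iff bot_nat_0.not_eq_extremum less_nat_zero_code
        norm_ge_zero)
  then have "w \<noteq> 0" by auto
  moreover have "w * (2 + w * (of_nat q - 2)) = 0"
    using zero by (simp add: algebra_simps power2_eq_square)
  ultimately have wq: "w * (of_nat q - 2) = - 2" by (simp add: eq_neg_iff_add_eq_0 add.commute)
  have "of_nat q - 2 = complex_of_real (real q - 2)" by simp
  then have "\<bar>real q - 2\<bar> = norm (of_nat q - 2 :: complex)" by (simp only: norm_of_real)
  also have "\<dots> = norm (w * (of_nat q - 2))" using norm by (simp add: norm_mult)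
  also have "\<dots> = 2" by (simp add: wq)
  finally have q: "q = 4" using assms(3) by linarith
  then have "w = - 1" using wq by simp
  then have "w ^ 2 = 1" by simp
  then have "n = 2" using w(2)[of 2] assms(2) by force
  then show False using q assms(4) by simp
qed

text \<open>The part common to both kinds of module: the flows enter only through
  \<open>count\<close>.\<close>

lemma sum_M11_eq_rank_poly:
  fixes F :: "('e \<Rightarrow> 'a::{ab_group_add,finite}) set" and w :: complex
  assumes "n > 1" "primitive_root_of_unity n w" "finite E" "q = CARD('a)" "\<not> (n = 2 \<and> q = 4)"
    and F: "F \<subseteq> E \<rightarrow>\<^sub>E UNIV"
    and count: "\<And>B. B \<subseteq> E \<Longrightarrow>
      card {h\<in>F. \<forall>e\<in>B. h e = 0} = CARD('a) ^ (rk I G E - rk I G B)"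
  shows "(\<Sum>k<n. w ^ k * of_nat (card (M11 E F k n))) =
    (1 - w) ^ (2 * rk I G E) * (2 * w + w\<^sup>2 * (of_nat q - 2)) ^ (card E - rk I G E) *
    rank_poly E (rk I G)
      (of_nat q * (2 * w + w\<^sup>2 * (of_nat q - 2)) / (1 - w)\<^sup>2)
      ((1 - w)\<^sup>2 / (2 * w + w\<^sup>2 * (of_nat q - 2)))"
proof -
  let ?x = "(1 - w)\<^sup>2" and ?y = "2 * w + w\<^sup>2 * (of_nat q - 2)"
  have w: "w ^ n = 1" "w ^ 1 \<noteq> 1"
    using assms(1,2) unfolding primitive_root_of_unity_def by blast+
  have x: "?x \<noteq> 0" using w(2) by simp
  have y: "?y \<noteq> 0" using weight_nonzero assms by (simp del: add_eq_0_iff)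
  have finF: "finite F"
    using finite_subset[OF F] assms(3) by (simp add: finite_PiE)
  have "(\<Sum>k<n. w ^ k * of_nat (card (M11 E F k n))) =
      (\<Sum>h\<in>F. \<Prod>e\<in>E. (if h e = 0 then ?x else 0) + ?y)"
    using assms(1) by (simp only: sum_M11[OF assms(3) _ w(1) F] sum_weights_eq_prod[OF assms(3)] assms(4))
  also have "\<dots> = (\<Sum>B\<in>Pow E. ?x ^ card B * ?y ^ card (E - B) * of_nat q ^ (rk I G E - rk I G B))"
    unfolding sum_prod_vanishing[OF assms(3) finF]
    by (intro sum.cong refl) (simp add: count assms(4))
  also have "\<dots> = ?x ^ rk I G E * ?y ^ (card E - rk I G E) *
      rank_poly E (rk I G) (of_nat q * ?y / ?x) (?x / ?y)"
    using assms(3) finite_subset x y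
    by (intro rank_poly_rescaled) (auto intro: rk_mono rk_le_card)
  finally show ?thesis by (simp only: power_mult)
qed

section \<open>The two module actions\<close>

lemma zmult_0: "zmult 0 a = 0"
  by (simp add: zmult_def)

lemma zmult_add_one: "zmult (m + 1) a = zmult m a + a"
proof (cases "0 \<le> m")
  case True
  then show ?thesis by (simp add: zmult_def nat_add_distrib add.commute)
next
  case False
  then have "nat (- m) = Suc (nat (- (m + 1)))" by simp
  then have "zmult m a = - (a + ((+) a ^^ nat (- (m + 1))) 0)" using False by (simp add: zmult_def)
  \<comment> \<open>At \<open>m = -1\<close> the successor is 0 and falls under the nonnegative
    branch of \<open>zmult\<close>.\<close>
  moreover have "zmult (m + 1) a = - ((+) a ^^ nat (- (m + 1))) 0"
    using False by (cases "m = -1") (auto simp: zmult_def)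
  ultimately show ?thesis by simp
qed

lemma zmult_diff_one: "zmult (m - 1) a = zmult m a - a"
  using zmult_add_one[of "m - 1" a] by simp

lemma zmult_add: "zmult (m + n) a = zmult m a + zmult n a"
proof (induction n rule: int_induct[where k = 0])
  case (step1 i)
  have "zmult (m + (i + 1)) a = zmult (m + i) a + a"
    using zmult_add_one[of "m + i" a] by (simp only: add.assoc)
  then show ?case using step1 by (simp only: zmult_add_one add.assoc)
next
  case (step2 i)
  have "zmult (m + (i - 1)) a = zmult (m + i) a - a"
    using zmult_diff_one[of "m + i" a] by (simp only: add_diff_eq)
  then show ?case using step2 by (simp only: zmult_diff_one add_diff_eq)
qed (simp add: zmult_0)

lemma zmult_diff: "zmult (m - n) a = zmult m a - zmult n a"
  using zmult_add[of "m - n" n a] by simp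

lemma module_zmult: "Modules.module (zmult :: int \<Rightarrow> 'a \<Rightarrow> 'a::ab_group_add)"
proof
  fix m n :: int and a b :: 'a
  show "zmult m (a + b) = zmult m a + zmult m b"
    by (induction m rule: int_induct[where k = 0])
      (simp_all add: zmult_0 zmult_add_one zmult_diff_one)
  show "zmult (m + n) a = zmult m a + zmult n a" by (rule zmult_add)
  show "zmult m (zmult n a) = zmult (m * n) a"
  proof (induction m rule: int_induct[where k = 0])
    case (step1 i)
    then show ?case
      using zmult_add[of "i * n" n a] by (simp only: zmult_add_one distrib_right mult_1)
  next
    case (step2 i)
    then show ?case
      using zmult_diff[of "i * n" n a] by (simp only: zmult_diff_one left_diff_distrib mult_1)
  qed (simp add: zmult_0)
  show "zmult 1 a = a" using zmult_add_one[of 0 a] by (simp add: zmult_0)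
qed

lemma module_vec: "Modules.module ((*s) :: 'k::field \<Rightarrow> 'k ^ 'd \<Rightarrow> 'k ^ 'd)"
  by (unfold_locales) (auto simp: vec_eq_iff algebra_simps)

theorem theorem4p2:
  fixes \<sigma> q r :: nat and \<omega> :: complex
    and E :: "'e set" and I :: "'i set" and J :: "'j set"
    and D :: "('v, 'e) pre_digraph" and D' :: "('w, 'e) pre_digraph"
    and G H :: "_ \<Rightarrow> 'e \<Rightarrow> int"
    and G\<^sub>F H\<^sub>F :: "_ \<Rightarrow> 'e \<Rightarrow> 'k::{field,finite}"
    and p s d :: nat
  assumes "\<sigma> > 1"
    and "primitive_root_of_unity \<sigma> \<omega>"
    and "finite E" and "finite I" and "finite J"
    and "\<not> (\<sigma> = 2 \<and> q = 4)"
  shows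
    "(graphic_or_unimodular D I E G \<and> graphic_or_unimodular D' J E H \<and>
      orthogonally_dual E I (ratmat G) J (ratmat H) \<and>
      r = rk I (ratmat G) E \<and> q = CARD('a::{ab_group_add,finite})
      \<longrightarrow>
      (\<Sum>k<\<sigma>. \<omega> ^ k * of_nat (card (M11 E (flows zmult E J H :: ('e \<Rightarrow> 'a) set) k \<sigma>))) =
        (1 - \<omega>) ^ (2 * r) * (2 * \<omega> + \<omega>\<^sup>2 * (of_nat q - 2)) ^ (card E - r) *
        rank_poly E (rk I (ratmat G))
          (of_nat q * (2 * \<omega> + \<omega>\<^sup>2 * (of_nat q - 2)) / (1 - \<omega>)\<^sup>2)
          ((1 - \<omega>)\<^sup>2 / (2 * \<omega> + \<omega>\<^sup>2 * (of_nat q - 2))))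
     \<and>
     (prime p \<and> CARD('k) = p ^ s \<and> CARD('d::finite) = d \<and>
      orthogonally_dual E I G\<^sub>F J H\<^sub>F \<and>
      r = rk I G\<^sub>F E \<and> q = p ^ (s * d)
      \<longrightarrow>
      (\<Sum>k<\<sigma>. \<omega> ^ k * of_nat (card (M11 E (flows (*s) E J H\<^sub>F :: ('e \<Rightarrow> 'k ^ 'd) set) k \<sigma>))) =
        (1 - \<omega>) ^ (2 * r) * (2 * \<omega> + \<omega>\<^sup>2 * (of_nat q - 2)) ^ (card E - r) *
        rank_poly E (rk I G\<^sub>F)
          (of_nat q * (2 * \<omega> + \<omega>\<^sup>2 * (of_nat q - 2)) / (1 - \<omega>)\<^sup>2)
          ((1 - \<omega>)\<^sup>2 / (2 * \<omega> + \<omega>\<^sup>2 * (of_nat q - 2))))"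
proof (intro conjI impI)
  assume *: "graphic_or_unimodular D I E G \<and> graphic_or_unimodular D' J E H \<and>
      orthogonally_dual E I (ratmat G) J (ratmat H) \<and>
      r = rk I (ratmat G) E \<and> q = CARD('a::{ab_group_add,finite})"
  have \<phi>: "inj_comm_ring_hom (of_int :: int \<Rightarrow> rat)" ..
  have "card {h \<in> (flows zmult E J H :: ('e \<Rightarrow> 'a) set). \<forall>e\<in>B. h e = 0} =
      CARD('a) ^ (rk I (ratmat G) E - rk I (ratmat G) B)" if "B \<subseteq> E" for B
    using * left_invertible_if_graphic_or_unimodular[of D' J E H] assms(3,5) that
    by (intro card_flows_vanishing_on_rk[OF module_zmult \<phi> assms(3-5)]) (auto simp: ratmat_def)
  then show "(\<Sum>k<\<sigma>. \<omega> ^ k * of_nat (card (M11 E (flows zmult E J H :: ('e \<Rightarrow> 'a) set) k \<sigma>))) =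
        (1 - \<omega>) ^ (2 * r) * (2 * \<omega> + \<omega>\<^sup>2 * (of_nat q - 2)) ^ (card E - r) *
        rank_poly E (rk I (ratmat G))
          (of_nat q * (2 * \<omega> + \<omega>\<^sup>2 * (of_nat q - 2)) / (1 - \<omega>)\<^sup>2)
          ((1 - \<omega>)\<^sup>2 / (2 * \<omega> + \<omega>\<^sup>2 * (of_nat q - 2)))"
    using sum_M11_eq_rank_poly[where F = "flows zmult E J H :: ('e \<Rightarrow> 'a) set" and G = "ratmat G"]
      * assms by (simp add: flows_def)
next
  assume *: "prime p \<and> CARD('k) = p ^ s \<and> CARD('d::finite) = d \<and>
      orthogonally_dual E I G\<^sub>F J H\<^sub>F \<and> r = rk I G\<^sub>F E \<and> q = p ^ (s * d)"
  \<comment> \<open>The coefficients already form a field, so the embedding is the identity.\<close>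
  have \<phi>: "inj_comm_ring_hom (\<lambda>x :: 'k. x)" by unfold_locales auto
  have q: "q = CARD('k ^ 'd)" using * by (simp add: power_mult)
  have "card {h \<in> (flows (*s) E J H\<^sub>F :: ('e \<Rightarrow> 'k ^ 'd) set). \<forall>e\<in>B. h e = 0} =
      CARD('k ^ 'd) ^ (rk I G\<^sub>F E - rk I G\<^sub>F B)" if "B \<subseteq> E" for B
    using * left_invertible_if_col_indep[of _ J H\<^sub>F] assms(3,5) that finite_subset
    by (intro card_flows_vanishing_on_rk[OF module_vec \<phi> assms(3-5)]) auto
  then show "(\<Sum>k<\<sigma>. \<omega> ^ k * of_nat (card (M11 E (flows (*s) E J H\<^sub>F :: ('e \<Rightarrow> 'k ^ 'd) set) k \<sigma>))) =
        (1 - \<omega>) ^ (2 * r) * (2 * \<omega> + \<omega>\<^sup>2 * (of_nat q - 2)) ^ (card E - r) *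
        rank_poly E (rk I G\<^sub>F)
          (of_nat q * (2 * \<omega> + \<omega>\<^sup>2 * (of_nat q - 2)) / (1 - \<omega>)\<^sup>2)
          ((1 - \<omega>)\<^sup>2 / (2 * \<omega> + \<omega>\<^sup>2 * (of_nat q - 2)))"
    using sum_M11_eq_rank_poly[where F = "flows (*s) E J H\<^sub>F :: ('e \<Rightarrow> 'k ^ 'd) set" and G = G\<^sub>F]
      * q assms by (simp add: flows_def)
qed

end
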